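(* Consider the following two assertions, each quantified over all $n\ge1$, all $n\times n$ skew-symmetrizable integer matrices $B$, all $T$ and $k_0,\dots,k_{T-1}\in\{1,\dots,n\}$, all permutations $\sigma$ of $\{1,\dots,n\}$ for which the sequence of seed mutations with coefficients in $\mathbb{Q}_+(y)$, $$(B,x,y)=(B[0],x[0],y[0])\overset{\mu_{k_0}}{\mapsto}\cdots\overset{\mu_{k_{T-1}}}{\mapsto}(B[T],x[T],y[T]),\qquad(\ast)$$ with initial $y$-variables the generators $y=(y_1,\dots,y_n)$ of $\mathbb{Q}_+(y)$, is $\sigma$-periodic, and all skew-symmetrizers $D=\mathrm{diag}(d_1,\dots,d_n)$ of $B$; here $\varepsilon_0,\dots,\varepsilon_{T-1}$ denotes the tropical sign sequence of $(\ast)$. (P) After setting the $y$-variables in $(\ast)$ to be trivial by the specialization $\mathbb{Q}_+(y)\to\mathbf{1}$, and with $\mathbb{Q}_+(x)\subset\mathcal{F}$ the semifield generated by the initial $x$-variables, the identity $$\sum_{s=0}^{T-1}\frac{\varepsilon_s}{d_{k_s}}\tilde{L}\big(\hat y_{k_s}[s]^{\varepsilon_s}\big)=0$$ holds, where $\hat y_i[s]=\prod_{j=1}^nx_j[s]^{b_{ji}[s]}$ are evaluated by any semifield homomorphism $\mathrm{ev}_x:\mathbb{Q}_+(x)\to\mathbb{R}_+$. (Q) The identity $$\sum_{s=0}^{T-1}\frac{\varepsilon_s}{d_{k_s}}\tilde{L}\big(y_{k_s}[s]^{\varepsilon_s}\big)=0$$ holds, where $y_{k_s}[s]$ are evaluated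 by any semifield homomorphism $\mathrm{ev}_y:\mathbb{Q}_+(y)\to\mathbb{R}_+$. Then (P) implies (Q). Therefore (P) and (Q) are equivalent.
   Context: Signs $\pm$ are identified with $\pm1$; $[a]_+=\max(a,0)$. $D$ (positive integers $d_i$) is a skew-symmetrizer of $B$ if $d_ib_{ij}=-d_jb_{ji}$. $\mathbb{R}_+$ is the semifield of positive reals with ordinary operations. Rogers dilogarithm: $\tilde L(x)=\frac12\int_0^x\left\{\frac{\log(1+y)}{y}-\frac{\log y}{1+y}\right\}dy$ for $x\ge0$. Seeds and mutations. A semifield $\mathbb{P}$ is a multiplicative abelian group with a commutative, associative, distributive addition $\oplus$. $\mathbb{Q}\mathbb{P}$ is the fraction field of the group ring $\mathbb{Z}\mathbb{P}$, and $\mathcal{F}$ is a purely transcendental extension of $\mathbb{Q}\mathbb{P}$ of degree $n$. A seed with coefficients in $\mathbb{P}$ is $(B,x,y)$ with $B$ an $n\times n$ skew-symmetrizable integer matrix, $x$ an $n$-tuple of algebraically independent elements of $\mathcal{F}$, $y$ an $n$-tuple of elements of $\mathbb{P}$. Its mutation at $k$ is $(B',x',y')=\mu_k(B,x,y)$: $b'_{ij}=-b_{ij}$ if $i=k$ or $j=k$, else $b'_{ij}=b_{ij}+[-\varepsilon b_{ik}]_+b_{kj}+b_{ik}[\varepsilon b_{kj}]_+$; $x'_i=x_i$ for $i\ne k$ and $x'_k=x_k^{-1}\big(\prod_jx_j^{[-\varepsilon b_{jk}]_+}\big)\frac{1+\hat y_k^{\varepsilon}}{1\oplus y_k^{\varepsilon}}$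 with $\hat y_i=y_i\prod_jx_j^{b_{ji}}$; $y'_k=y_k^{-1}$ and $y'_i=y_iy_k^{[\varepsilon b_{ki}]_+}(1\oplus y_k^{\varepsilon})^{-b_{ki}}$ for $i\neq k$. (All independent of the sign $\varepsilon$.) $\mathbf{1}=\{1\}$ is the trivial semifield, $1\oplus1=1$; after specialization to $\mathbf{1}$ the $x$-variables mutate by $x'_k=x_k^{-1}\big(\prod_jx_j^{[-\varepsilon b_{jk}]_+}\big)(1+\hat y_k^{\varepsilon})$ with $\hat y_k=\prod_jx_j^{b_{jk}}$. $\mathbb{Q}_+(y)$: the semifield of rational functions $p(y)/q(y)\in\mathbb{Q}(y)$ with $p,q$ nonzero polynomials with nonnegative integer coefficients. $\mathrm{Trop}(y)$: Laurent monomials $\prod y_i^{a_i}$ with ordinary multiplication and $\prod y_i^{a_i}\oplus\prod y_i^{b_i}=\prod y_i^{\min(a_i,b_i)}$. $\pi_{\mathrm{trop}}:\mathbb{Q}_+(y)\to\mathrm{Trop}(y)$ is the semifield homomorphism with $y_i\mapsto y_i$. The $c$-vector $(c_{ji}[s])_{j}$ of $y_i[s]$ (in $\mathbb{Q}_+(y)$) is given by $\pi_{\mathrm{trop}}(y_i[s])=\prod_jy_j^{c_{ji}[s]}$; it is known to be nonzero with components all nonnegative or all nonpositive, and the tropical sign $\varepsilon(y_i[s])$ is $+$ or $-$ accordingly. The tropical sign sequence of $(\ast)$ is $\varepsilon_s=\varepsilon(y_{k_s}[s])$, $s=0,\dots,T-1$. $(\ast)$ is $\sigma$-periodic if $b_{\sigma^{-1}(i)\sigma^{-1}(j)}[T]=b_{ij}[0]$,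 $x_{\sigma^{-1}(i)}[T]=x_i[0]$, $y_{\sigma^{-1}(i)}[T]=y_i[0]$ for all $i,j$ (before specialization). *)

theory Defs
  imports
    "HOL-Analysis.Analysis"
    "HOL-Library.Poly_Mapping"
    "HOL-Computational_Algebra.Fraction_Field"
begin

section \<open>Semifields\<close>

text \<open>The semifield addition is written \<open>+\<close>; there is no zero element.\<close>

class semifield = comm_semiring + comm_monoid_mult + inverse +
  assumes semifield_left_inverse: "inverse a * a = 1"
    and semifield_divide: "a / b = a * inverse b"

definition semifield_hom ::
    "'a::{plus,times} set \<Rightarrow> 'b::{plus,times} set \<Rightarrow> ('a \<Rightarrow> 'b) \<Rightarrow> bool" where
  "semifield_hom A C f \<longleftrightarrow> (\<forall>a\<in>A. f a \<in> C) \<and>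
     (\<forall>a\<in>A. \<forall>b\<in>A. f (a + b) = f a + f b \<and> f (a * b) = f a * f b)"

lemma semifield_mult_left_cancel:
  fixes a b c :: "'a::semifield"
  shows "c * a = c * b \<longleftrightarrow> a = b"
proof
  assume "c * a = c * b"
  then have "inverse c * c * a = inverse c * c * b" by (simp only: mult.assoc)
  then show "a = b" by (simp only: semifield_left_inverse mult_1_left)
qed simp

lemma semifield_torsion_free:
  fixes p :: "'p::semifield"
  assumes "p ^ Suc m = 1"
  shows "p = 1"
proof (cases m)
  case 0
  with assms show ?thesis by simp
next
  case (Suc j)
  define R where "R = rec_nat p (\<lambda>i r. r + p ^ Suc (Suc i))"
  have R0: "R 0 = p" and RS: "R (Suc i) = R i + p ^ Suc (Suc i)" for i
    by (simp_all add: R_def)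
  have step: "p * (1 + R i) = R (Suc i)" for i
  proof (induction i)
    case 0
    show ?case by (simp add: R0 RS[of 0] distrib_left)
  next
    case (Suc i)
    have "p * (1 + R (Suc i)) = p * (1 + R i) + p * p ^ Suc (Suc i)"
      by (simp only: RS[of i] distrib_left add.assoc)
    also have "\<dots> = R (Suc i) + p ^ Suc (Suc (Suc i))" by (simp only: Suc power_Suc)
    finally show ?case by (simp only: RS[of "Suc i"])
  qed
  have "p * (1 + R j) = R j + p ^ Suc m"
    unfolding step RS Suc ..
  also have "\<dots> = 1 + R j"
    unfolding assms by (rule add.commute)
  finally have "(1 + R j) * p = (1 + R j) * 1"
    by (simp only: mult.commute[of "1 + R j" p] mult_1_right)
  then show ?thesis by (simp only: semifield_mult_left_cancel)
qed

instantiation unit :: semifield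
begin
definition plus_unit :: "unit \<Rightarrow> unit \<Rightarrow> unit" where "plus_unit a b = ()"
definition times_unit :: "unit \<Rightarrow> unit \<Rightarrow> unit" where "times_unit a b = ()"
definition one_unit :: unit where "one_unit = ()"
definition inverse_unit :: "unit \<Rightarrow> unit" where "inverse_unit a = ()"
definition divide_unit :: "unit \<Rightarrow> unit \<Rightarrow> unit" where "divide_unit a b = ()"
instance by standard simp_all
end


section \<open>The ambient field of a semifield of coefficients\<close>

text \<open>
  The multiplicative group of a semifield, written additively, so that \<open>'p mult_grp \<Rightarrow>\<^sub>0 int\<close>
  is its integral group ring.  It is torsion-free and hence carries a translation-invariant
  linear order; an arbitrary one is chosen, with the sole purpose of making the group ring an
  instance of \<open>idom\<close>.
\<close>

typedef 'p mult_grp = "UNIV :: 'p set" morphisms of_grp to_grp ..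

setup_lifting type_definition_mult_grp

instantiation mult_grp :: (semifield) ab_group_add
begin
lift_definition zero_mult_grp :: "'a mult_grp" is 1 .
lift_definition plus_mult_grp :: "'a mult_grp \<Rightarrow> 'a mult_grp \<Rightarrow> 'a mult_grp" is "(*)" .
lift_definition uminus_mult_grp :: "'a mult_grp \<Rightarrow> 'a mult_grp" is inverse .
lift_definition minus_mult_grp :: "'a mult_grp \<Rightarrow> 'a mult_grp \<Rightarrow> 'a mult_grp" is "(/)" .
instance
proof
  fix a b c :: "'a mult_grp"
  show "a + b + c = a + (b + c)" by transfer (rule mult.assoc)
  show "a + b = b + a" by transfer (rule mult.commute)
  show "0 + a = a" by transfer (rule mult_1_left)
  show "- a + a = 0" by transfer (rule semifield_left_inverse)
  show "a - b = a + - b" by transfer (rule semifield_divide)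
qed
end

definition mult_cone :: "'p::semifield mult_grp set \<Rightarrow> bool" where
  "mult_cone C \<longleftrightarrow> 0 \<in> C \<and> (\<forall>a\<in>C. \<forall>b\<in>C. a + b \<in> C) \<and> (\<forall>a\<in>C. - a \<in> C \<longrightarrow> a = 0)"

definition nsmul :: "nat \<Rightarrow> 'a::monoid_add \<Rightarrow> 'a" where
  "nsmul m a = ((+) a ^^ m) 0"

lemma nsmul_simps [simp]: "nsmul 0 a = 0" "nsmul (Suc m) a = a + nsmul m a"
  by (simp_all add: nsmul_def)

lemma nsmul_add: "nsmul (m + l) a = nsmul m a + nsmul l (a::'a::monoid_add)"
  by (induction m) (simp_all add: add.assoc)

lemma nsmul_minus: "nsmul m (- a) = - nsmul m (a::'a::ab_group_add)"
  by (induction m) simp_all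

lemma nsmul_mult: "nsmul (m * l) a = nsmul m (nsmul l (a::'a::monoid_add))"
  by (induction m) (simp_all add: nsmul_add)

lemma of_grp_nsmul: "of_grp (nsmul m a) = of_grp a ^ m"
  by (induction m) (simp_all add: zero_mult_grp.rep_eq plus_mult_grp.rep_eq)

lemma mult_grp_torsion_free: "nsmul (Suc m) (a::'p::semifield mult_grp) = 0 \<Longrightarrow> a = 0"
  using semifield_torsion_free[of "of_grp a" m]
  by (metis of_grp_nsmul of_grp_inject zero_mult_grp.rep_eq)

lemma mult_cone_nsmul: "mult_cone C \<Longrightarrow> a \<in> C \<Longrightarrow> nsmul m a \<in> C"
  by (induction m) (auto simp: mult_cone_def)

lemma mult_cone_extend:
  assumes C: "mult_cone (C::'p::semifield mult_grp set)"
    and max: "\<And>C'. mult_cone C' \<Longrightarrow> C \<subseteq> C' \<Longrightarrow> C' = C"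
    and a: "a \<notin> C"
  shows "\<exists>m. - nsmul (Suc m) a \<in> C"
proof (rule ccontr)
  assume neg: "\<not> ?thesis"
  define C' where "C' = {c + nsmul m a | c m. c \<in> C}"
  have "mult_cone C'"
    unfolding mult_cone_def
  proof (intro conjI ballI impI)
    show "0 \<in> C'"
      using C unfolding C'_def mult_cone_def by (auto intro!: exI[of _ 0])
  next
    fix u v assume "u \<in> C'" "v \<in> C'"
    then obtain c m c' m' where "u = c + nsmul m a" "v = c' + nsmul m' a" "c \<in> C" "c' \<in> C"
      by (auto simp: C'_def)
    then have "u + v = (c + c') + nsmul (m + m') a" "c + c' \<in> C"
      using C by (auto simp: nsmul_add algebra_simps mult_cone_def)
    then show "u + v \<in> C'" unfolding C'_def by blast
  next
    fix u assume "u \<in> C'" "- u \<in> C'"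
    then obtain c m c' m' where u: "u = c + nsmul m a" "- u = c' + nsmul m' a" "c \<in> C" "c' \<in> C"
      by (auto simp: C'_def)
    then have "c + nsmul m a + (c' + nsmul m' a) = 0"
      by (metis add.right_inverse)
    then have "(c + c') + nsmul (m + m') a = 0"
      by (simp add: nsmul_add algebra_simps)
    then have eq: "- nsmul (m + m') a = c + c'"
      by (metis add.commute minus_unique)
    have "c + c' \<in> C" using C u by (auto simp: mult_cone_def)
    then have "m + m' = 0" using eq neg by (metis not0_implies_Suc)
    then show "u = 0" using u C by (auto simp: mult_cone_def)
  qed
  moreover have "C \<subseteq> C'"
  proof
    fix c assume "c \<in> C"
    then have "c = c + nsmul 0 a" "c \<in> C" by simp_all
    then show "c \<in> C'" unfolding C'_def by blast
  qed
  moreover have "a \<in> C'"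
  proof -
    have "a = 0 + nsmul 1 a" "0 \<in> C" using C by (auto simp: mult_cone_def)
    then show ?thesis unfolding C'_def by blast
  qed
  ultimately show False using max a by blast
qed

lemma total_mult_cone_exists:
  "\<exists>C::'p::semifield mult_grp set. mult_cone C \<and> (\<forall>a. a \<in> C \<or> - a \<in> C)"
proof -
  let ?A = "{C::'p mult_grp set. mult_cone C}"
  have "\<exists>M\<in>?A. \<forall>X\<in>?A. M \<subseteq> X \<longrightarrow> X = M"
  proof (rule subset_Zorn_nonempty)
    have "{0} \<in> ?A" by (simp add: mult_cone_def)
    then show "?A \<noteq> {}" by blast
  next
    fix K assume K: "K \<noteq> {}" "subset.chain ?A K"
    then have cone: "\<And>C. C \<in> K \<Longrightarrow> mult_cone C"
      and lin: "\<And>C D. C \<in> K \<Longrightarrow> D \<in> K \<Longrightarrow> C \<subseteq> D \<or> D \<subseteq> C"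
      by (auto simp: subset.chain_def)
    have "mult_cone (\<Union>K)"
      unfolding mult_cone_def
    proof (intro conjI ballI impI)
      show "0 \<in> \<Union>K" using K(1) cone by (auto simp: mult_cone_def)
    next
      fix a b assume "a \<in> \<Union>K" "b \<in> \<Union>K"
      then obtain C where "C \<in> K" "a \<in> C" "b \<in> C" using lin by blast
      then show "a + b \<in> \<Union>K" using cone[of C] by (auto simp: mult_cone_def)
    next
      fix a assume "a \<in> \<Union>K" "- a \<in> \<Union>K"
      then obtain C where "C \<in> K" "a \<in> C" "- a \<in> C" using lin by blast
      then show "a = 0" using cone[of C] by (auto simp: mult_cone_def)
    qed
    then show "\<Union>K \<in> ?A" by simp
  qed
  then obtain C :: "'p mult_grp set" where C: "mult_cone C"
    and max: "\<And>C'. mult_cone C' \<Longrightarrow> C \<subseteq> C' \<Longrightarrow> C' = C" by auto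
  have "a \<in> C \<or> - a \<in> C" for a
  proof (rule ccontr)
    assume neg: "\<not> (a \<in> C \<or> - a \<in> C)"
    obtain m where m: "- nsmul (Suc m) a \<in> C"
      using mult_cone_extend[OF C max] neg by blast
    obtain l where l: "nsmul (Suc l) a \<in> C"
      using mult_cone_extend[OF C max, of "- a"] neg by (auto simp: nsmul_minus algebra_simps)
    have 1: "- nsmul (Suc l * Suc m) a \<in> C"
      using mult_cone_nsmul[OF C m, of "Suc l"] by (simp only: nsmul_mult nsmul_minus)
    have 2: "nsmul (Suc l * Suc m) a \<in> C"
      using mult_cone_nsmul[OF C l, of "Suc m"] by (simp only: nsmul_mult[symmetric] mult.commute)
    have "nsmul (Suc l * Suc m) a = 0"
      using 1 2 C by (auto simp only: mult_cone_def)
    then have "nsmul (Suc (m + l * Suc m)) a = 0" by (simp only: mult_Suc add_Suc)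
    then have "a = 0" by (rule mult_grp_torsion_free)
    then show False using neg C by (auto simp: mult_cone_def)
  qed
  with C show ?thesis by blast
qed

definition total_cone :: "'p::semifield mult_grp set" where
  "total_cone = (SOME C. mult_cone C \<and> (\<forall>a. a \<in> C \<or> - a \<in> C))"

lemma total_cone: "mult_cone total_cone" "a \<in> total_cone \<or> - a \<in> total_cone"
  using someI_ex[OF total_mult_cone_exists] unfolding total_cone_def by blast+

instantiation mult_grp :: (semifield) linordered_ab_group_add
begin
definition less_eq_mult_grp :: "'a mult_grp \<Rightarrow> 'a mult_grp \<Rightarrow> bool" where
  "less_eq_mult_grp a b \<longleftrightarrow> b - a \<in> total_cone"
definition less_mult_grp :: "'a mult_grp \<Rightarrow> 'a mult_grp \<Rightarrow> bool" where
  "less_mult_grp a b \<longleftrightarrow> a \<le> b \<and> \<not> b \<le> a"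
instance
proof
  fix a b c :: "'a mult_grp"
  show "a < b \<longleftrightarrow> a \<le> b \<and> \<not> b \<le> a" by (rule less_mult_grp_def)
  show "a \<le> a" using total_cone(1) by (auto simp: less_eq_mult_grp_def mult_cone_def)
  show "a \<le> c" if "a \<le> b" "b \<le> c"
  proof -
    have "(c - b) + (b - a) \<in> total_cone"
      using that total_cone(1) unfolding less_eq_mult_grp_def mult_cone_def by blast
    then show ?thesis by (simp add: less_eq_mult_grp_def)
  qed
  show "a = b" if "a \<le> b" "b \<le> a"
  proof -
    have "- (b - a) \<in> total_cone" using that by (simp add: less_eq_mult_grp_def)
    then have "b - a = 0"
      using that total_cone(1) unfolding less_eq_mult_grp_def mult_cone_def by blast
    then show ?thesis by simp
  qed
  show "a \<le> b \<or> b \<le> a"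
    using total_cone(2)[of "b - a"] by (simp add: less_eq_mult_grp_def)
  show "c + a \<le> c + b" if "a \<le> b"
    using that by (simp add: less_eq_mult_grp_def)
qed
end

text \<open>
  The field \<open>QP\<close> and the ambient field \<open>F\<close>.  Polynomials have variables indexed by all natural
  numbers, as the rank is not known to the type system; rank \<open>n\<close> uses the variables
  \<open>0, \<dots>, n - 1\<close> only, and all cluster variables of a rank \<open>n\<close> seed obtained by mutation
  lie in the rational functions over \<open>QP\<close> in these \<open>n\<close> variables.
\<close>

type_synonym 'a mpoly = "(nat \<Rightarrow>\<^sub>0 nat) \<Rightarrow>\<^sub>0 'a"
type_synonym 'p coeff_field = "('p mult_grp \<Rightarrow>\<^sub>0 int) fract"
type_synonym 'p ambient = "'p coeff_field mpoly fract"

definition mvar :: "nat \<Rightarrow> 'a::zero_neq_one mpoly" where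
  "mvar i = Poly_Mapping.single (Poly_Mapping.single i 1) 1"

definition xvar :: "nat \<Rightarrow> 'p::semifield ambient" where
  "xvar i = Fract (mvar i) 1"

definition emb :: "'p::semifield \<Rightarrow> 'p ambient" where
  "emb p = Fract (Poly_Mapping.single 0 (Fract (Poly_Mapping.single (to_grp p) 1) 1)) 1"

inductive_set gen_semifield :: "'a::field set \<Rightarrow> 'a set" for A where
  gen: "a \<in> A \<Longrightarrow> a \<in> gen_semifield A"
| add: "a \<in> gen_semifield A \<Longrightarrow> b \<in> gen_semifield A \<Longrightarrow> a + b \<in> gen_semifield A"
| mult: "a \<in> gen_semifield A \<Longrightarrow> b \<in> gen_semifield A \<Longrightarrow> a * b \<in> gen_semifield A"
| divide: "a \<in> gen_semifield A \<Longrightarrow> b \<in> gen_semifield A \<Longrightarrow> a / b \<in> gen_semifield A"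


section \<open>Seeds and mutations\<close>

text \<open>Indices \<open>1, \<dots>, n\<close> become \<open>0, \<dots>, n - 1\<close>; values at other indices are irrelevant.\<close>

record (overloaded) 'p seed =
  exch :: "nat \<Rightarrow> nat \<Rightarrow> int"
  clus :: "nat \<Rightarrow> 'p ambient"
  coef :: "nat \<Rightarrow> 'p"

abbreviation pos_part :: "int \<Rightarrow> int" where
  "pos_part a \<equiv> max a 0"

definition skew_symmetrizer :: "nat \<Rightarrow> (nat \<Rightarrow> int) \<Rightarrow> (nat \<Rightarrow> nat \<Rightarrow> int) \<Rightarrow> bool" where
  "skew_symmetrizer n d B \<longleftrightarrow>
     (\<forall>i<n. d i > 0) \<and> (\<forall>i<n. \<forall>j<n. d i * B i j = - d j * B j i)"

definition skew_symmetrizable :: "nat \<Rightarrow> (nat \<Rightarrow> nat \<Rightarrow> int) \<Rightarrow> bool" where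
  "skew_symmetrizable n B \<longleftrightarrow> (\<exists>d. skew_symmetrizer n d B)"

definition yhat :: "nat \<Rightarrow> 'p::semifield seed \<Rightarrow> nat \<Rightarrow> 'p ambient" where
  "yhat n S i = emb (coef S i) * (\<Prod>j<n. clus S j powi exch S j i)"

definition mutate_sign :: "int \<Rightarrow> nat \<Rightarrow> nat \<Rightarrow> 'p::semifield seed \<Rightarrow> 'p seed" where
  "mutate_sign \<epsilon> n k S =
    (let b = exch S; x = clus S; y = coef S in
     \<lparr>exch = (\<lambda>i j. if i = k \<or> j = k then - b i j
                     else b i j + pos_part (- \<epsilon> * b i k) * b k j + b i k * pos_part (\<epsilon> * b k j)),
      clus = (\<lambda>i. if i = k
                   then inverse (x k) * (\<Prod>j<n. x j powi pos_part (- \<epsilon> * b j k))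
                          * ((1 + yhat n S k powi \<epsilon>) / emb (1 + y k powi \<epsilon>))
                   else x i),
      coef = (\<lambda>i. if i = k then inverse (y k)
                   else y i * y k powi pos_part (\<epsilon> * b k i) * (1 + y k powi \<epsilon>) powi (- b k i))\<rparr>)"

text \<open>For a skew-symmetrizable exchange matrix the result does not depend on the sign \<open>\<epsilon>\<close>.\<close>

definition mutate :: "nat \<Rightarrow> nat \<Rightarrow> 'p::semifield seed \<Rightarrow> 'p seed" where
  "mutate = mutate_sign 1"

definition initial_seed :: "(nat \<Rightarrow> nat \<Rightarrow> int) \<Rightarrow> (nat \<Rightarrow> 'p::semifield) \<Rightarrow> 'p seed" where
  "initial_seed B y = \<lparr>exch = B, clus = xvar, coef = y\<rparr>"

primrec seed_seq ::
    "nat \<Rightarrow> (nat \<Rightarrow> nat) \<Rightarrow> 'p::semifield seed \<Rightarrow> nat \<Rightarrow> 'p seed" where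
  "seed_seq n k S 0 = S"
| "seed_seq n k S (Suc s) = mutate n (k s) (seed_seq n k S s)"

definition sigma_periodic :: "nat \<Rightarrow> (nat \<Rightarrow> nat) \<Rightarrow> 'p::semifield seed \<Rightarrow> 'p seed \<Rightarrow> bool" where
  "sigma_periodic n \<sigma> S S' \<longleftrightarrow>
     (\<forall>i<n. \<forall>j<n. exch S' (inv \<sigma> i) (inv \<sigma> j) = exch S i j) \<and>
     (\<forall>i<n. clus S' (inv \<sigma> i) = clus S i) \<and>
     (\<forall>i<n. coef S' (inv \<sigma> i) = coef S i)"


section \<open>The universal semifield and the tropical semifield\<close>

definition nonneg_poly :: "int mpoly \<Rightarrow> bool" where
  "nonneg_poly p \<longleftrightarrow> p \<noteq> 0 \<and> (\<forall>m. 0 \<le> Poly_Mapping.lookup p m)"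

lemma nonneg_poly_nonzero: "nonneg_poly p \<Longrightarrow> p \<noteq> 0"
  by (simp add: nonneg_poly_def)

lemma nonneg_poly_1 [simp]: "nonneg_poly 1"
  by (simp add: nonneg_poly_def lookup_one when_def)

lemma nonneg_poly_mvar [simp]: "nonneg_poly (mvar i)"
proof -
  have "Poly_Mapping.lookup (mvar i :: int mpoly) (Poly_Mapping.single i 1) = 1"
    by (simp add: mvar_def)
  then have "(mvar i :: int mpoly) \<noteq> 0" by fastforce
  then show ?thesis by (simp add: nonneg_poly_def mvar_def lookup_single when_def)
qed

text \<open>As for the ambient field, the type has variables \<open>y\<^sub>i\<close> for all natural numbers \<open>i\<close>.\<close>

typedef qplus = "{Fract p q | p q. nonneg_poly p \<and> nonneg_poly q}" morphisms rat_fun Abs_qplus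
  using nonneg_poly_1 by blast

text \<open>The semifield of the rational functions in \<open>y\<^sub>0, \<dots>, y\<^sub>n\<^sub>-\<^sub>1\<close>.\<close>

definition qplus_vars :: "nat \<Rightarrow> qplus set" where
  "qplus_vars n = {f. \<exists>p q. nonneg_poly p \<and> nonneg_poly q \<and> rat_fun f = Fract p q \<and>
     (\<forall>m \<in> Poly_Mapping.keys p \<union> Poly_Mapping.keys q. Poly_Mapping.keys m \<subseteq> {..<n})}"

lemma mpoly_eq_sum_single:
  "(p :: 'a::comm_monoid_add \<Rightarrow>\<^sub>0 'b::comm_semiring_1)
     = (\<Sum>a\<in>Poly_Mapping.keys p. Poly_Mapping.single a (Poly_Mapping.lookup p a))"
  by (rule poly_mapping_eqI)
     (simp add: lookup_sum lookup_single when_def sum.delta' in_keys_iff)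

lemma lookup_mult_sum:
  fixes p q :: "int mpoly"
  shows "Poly_Mapping.lookup (p * q) m =
    (\<Sum>a\<in>Poly_Mapping.keys p. \<Sum>b\<in>Poly_Mapping.keys q.
       if a + b = m then Poly_Mapping.lookup p a * Poly_Mapping.lookup q b else 0)"
proof -
  have "p * q = (\<Sum>a\<in>Poly_Mapping.keys p. Poly_Mapping.single a (Poly_Mapping.lookup p a)) *
                (\<Sum>b\<in>Poly_Mapping.keys q. Poly_Mapping.single b (Poly_Mapping.lookup q b))"
    using mpoly_eq_sum_single[of p] mpoly_eq_sum_single[of q] by simp
  also have "\<dots> = (\<Sum>a\<in>Poly_Mapping.keys p. \<Sum>b\<in>Poly_Mapping.keys q.
                 Poly_Mapping.single (a + b) (Poly_Mapping.lookup p a * Poly_Mapping.lookup q b))"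
    by (simp add: sum_product mult_single)
  finally show ?thesis
    by (simp add: lookup_sum lookup_single when_def)
qed

lemma nonneg_poly_mult_aux:
  assumes "nonneg_poly p" "nonneg_poly q"
  shows "Poly_Mapping.keys (p * q) =
           (\<lambda>(a, b). a + b) ` (Poly_Mapping.keys p \<times> Poly_Mapping.keys q)"
    and "0 \<le> Poly_Mapping.lookup (p * q) m"
proof -
  have nn: "0 \<le> Poly_Mapping.lookup p a" "0 \<le> Poly_Mapping.lookup q a" for a
    using assms by (auto simp: nonneg_poly_def)
  show ge: "0 \<le> Poly_Mapping.lookup (p * q) m" for m
    unfolding lookup_mult_sum by (intro sum_nonneg) (simp add: nn)
  have "a + b \<in> Poly_Mapping.keys (p * q)"
    if a: "a \<in> Poly_Mapping.keys p" and b: "b \<in> Poly_Mapping.keys q" for a b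
  proof -
    have "0 < Poly_Mapping.lookup p a * Poly_Mapping.lookup q b"
      using a b nn by (simp add: in_keys_iff order_less_le)
    also have "\<dots> \<le> (\<Sum>b'\<in>Poly_Mapping.keys q.
        if a + b' = a + b then Poly_Mapping.lookup p a * Poly_Mapping.lookup q b' else 0)"
      using b by simp
    also have "\<dots> \<le> Poly_Mapping.lookup (p * q) (a + b)"
      unfolding lookup_mult_sum
      by (rule member_le_sum[OF a]) (auto intro!: sum_nonneg simp: nn)
    finally show ?thesis by (simp add: in_keys_iff)
  qed
  then show "Poly_Mapping.keys (p * q) =
      (\<lambda>(a, b). a + b) ` (Poly_Mapping.keys p \<times> Poly_Mapping.keys q)"
    using keys_mult[of p q] by fastforce
qed

lemma nonneg_poly_mult: "nonneg_poly p \<Longrightarrow> nonneg_poly q \<Longrightarrow> nonneg_poly (p * q)"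
  using nonneg_poly_mult_aux(2)[of p q] by (simp add: nonneg_poly_def)

lemma nonneg_poly_keys_add:
  assumes "nonneg_poly p" "nonneg_poly q"
  shows "Poly_Mapping.keys (p + q) = Poly_Mapping.keys p \<union> Poly_Mapping.keys q"
proof (rule set_eqI)
  fix m
  have "0 \<le> Poly_Mapping.lookup p m" "0 \<le> Poly_Mapping.lookup q m"
    using assms by (simp_all add: nonneg_poly_def)
  then show "m \<in> Poly_Mapping.keys (p + q) \<longleftrightarrow> m \<in> Poly_Mapping.keys p \<union> Poly_Mapping.keys q"
    by (simp add: in_keys_iff lookup_add add_nonneg_eq_0_iff)
qed

lemma nonneg_poly_add: "nonneg_poly p \<Longrightarrow> nonneg_poly q \<Longrightarrow> nonneg_poly (p + q)"
proof -
  assume p: "nonneg_poly p" and q: "nonneg_poly q"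
  have "Poly_Mapping.keys (p + q) \<noteq> {}"
    using nonneg_poly_keys_add[OF p q] nonneg_poly_nonzero[OF p] by simp
  then have "p + q \<noteq> 0" by fastforce
  then show ?thesis using p q by (simp add: nonneg_poly_def lookup_add)
qed

setup_lifting type_definition_qplus

instantiation qplus :: semifield
begin
lift_definition one_qplus :: qplus is 1
  unfolding One_fract_def using nonneg_poly_1 by blast
lift_definition plus_qplus :: "qplus \<Rightarrow> qplus \<Rightarrow> qplus" is "(+)"
proof clarsimp
  fix p q p' q' :: "int mpoly"
  assume "nonneg_poly p" "nonneg_poly q" "nonneg_poly p'" "nonneg_poly q'"
  then show "\<exists>r s. Fract p q + Fract p' q' = Fract r s \<and> nonneg_poly r \<and> nonneg_poly s"
    by (intro exI[of _ "p * q' + p' * q"] exI[of _ "q * q'"])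
       (simp add: nonneg_poly_add nonneg_poly_mult nonneg_poly_nonzero)
qed
lift_definition times_qplus :: "qplus \<Rightarrow> qplus \<Rightarrow> qplus" is "(*)"
  by clarsimp (blast intro: nonneg_poly_mult)
lift_definition inverse_qplus :: "qplus \<Rightarrow> qplus" is inverse
  by clarsimp blast
lift_definition divide_qplus :: "qplus \<Rightarrow> qplus \<Rightarrow> qplus" is "(/)"
  by clarsimp (blast intro: nonneg_poly_mult)
instance
proof
  fix a b c :: qplus
  show "inverse a * a = 1"
    by transfer (auto simp: nonneg_poly_def One_fract_def eq_fract)
  show "a div b = a * inverse b"
    by transfer (simp add: divide_inverse)
qed (transfer; simp add: algebra_simps)+
end

lift_definition yvar :: "nat \<Rightarrow> qplus" is "\<lambda>i. Fract (mvar i) 1"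
  using nonneg_poly_1 nonneg_poly_mvar by blast

text \<open>Laurent monomials, represented by their exponents.\<close>

typedef trop = "{e :: nat \<Rightarrow> int. finite {i. e i \<noteq> 0}}" morphisms trop_exponent Abs_trop
  by (auto intro!: exI[of _ "\<lambda>_. 0"])

setup_lifting type_definition_trop

instantiation trop :: semifield
begin
lift_definition one_trop :: trop is "\<lambda>_. 0" by simp
lift_definition plus_trop :: "trop \<Rightarrow> trop \<Rightarrow> trop" is "\<lambda>a b i. min (a i) (b i)"
proof -
  fix a b :: "nat \<Rightarrow> int"
  assume "finite {i. a i \<noteq> 0}" "finite {i. b i \<noteq> 0}"
  then have "finite ({i. a i \<noteq> 0} \<union> {i. b i \<noteq> 0})" by simp
  then show "finite {i. min (a i) (b i) \<noteq> 0}"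
    by (rule rev_finite_subset) auto
qed
lift_definition times_trop :: "trop \<Rightarrow> trop \<Rightarrow> trop" is "\<lambda>a b i. a i + b i"
proof -
  fix a b :: "nat \<Rightarrow> int"
  assume "finite {i. a i \<noteq> 0}" "finite {i. b i \<noteq> 0}"
  then have "finite ({i. a i \<noteq> 0} \<union> {i. b i \<noteq> 0})" by simp
  then show "finite {i. a i + b i \<noteq> 0}"
    by (rule rev_finite_subset) auto
qed
lift_definition inverse_trop :: "trop \<Rightarrow> trop" is "\<lambda>a i. - a i" by simp
lift_definition divide_trop :: "trop \<Rightarrow> trop \<Rightarrow> trop" is "\<lambda>a b i. a i - b i"
proof -
  fix a b :: "nat \<Rightarrow> int"
  assume "finite {i. a i \<noteq> 0}" "finite {i. b i \<noteq> 0}"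
  then have "finite ({i. a i \<noteq> 0} \<union> {i. b i \<noteq> 0})" by simp
  then show "finite {i. a i - b i \<noteq> 0}"
    by (rule rev_finite_subset) auto
qed
instance by standard (transfer; force simp: min_def)+
end

lift_definition trop_var :: "nat \<Rightarrow> trop" is "\<lambda>i j. if j = i then 1 else 0"
  by simp

text \<open>
  The next lemmas show that the definite description in \<open>pi_trop\<close> is proper: a homomorphism
  sending \<open>y\<^sub>i\<close> to \<open>y\<^sub>i\<close> exists (take minimal exponents) and is unique.
\<close>

lemma semifield_hom_one:
  fixes f :: "'a::semifield \<Rightarrow> 'b::semifield"
  assumes "semifield_hom UNIV UNIV f"
  shows "f 1 = 1"
proof -
  have "f 1 * f 1 = f 1 * 1"
    using assms unfolding semifield_hom_def by (metis UNIV_I mult_1_right)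
  then show ?thesis by (simp only: semifield_mult_left_cancel)
qed

lemma semifield_hom_inverse:
  fixes f :: "'a::semifield \<Rightarrow> 'b::semifield"
  assumes "semifield_hom UNIV UNIV f"
  shows "f (inverse a) = inverse (f a)"
proof -
  have "f a * f (inverse a) = f (inverse a * a)"
    using assms unfolding semifield_hom_def by (metis UNIV_I mult.commute)
  also have "\<dots> = f a * inverse (f a)"
    using semifield_hom_one[OF assms]
    by (simp only: semifield_left_inverse mult.commute[of "f a"])
  finally show ?thesis by (simp only: semifield_mult_left_cancel)
qed

lemma qplus_hom_unique:
  fixes f g :: "qplus \<Rightarrow> 'b::semifield"
  assumes f: "semifield_hom UNIV UNIV f" and g: "semifield_hom UNIV UNIV g"
    and eq: "\<And>i. f (yvar i) = g (yvar i)"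
  shows "f = g"
proof
  have f_ops: "f (a + b) = f a + f b" "f (a * b) = f a * f b" "f 1 = 1" for a b
    using f semifield_hom_one[OF f] by (auto simp: semifield_hom_def)
  have g_ops: "g (a + b) = g a + g b" "g (a * b) = g a * g b" "g 1 = 1" for a b
    using g semifield_hom_one[OF g] by (auto simp: semifield_hom_def)
  have monom: "\<exists>h. rat_fun h = Fract (Poly_Mapping.single m 1) 1 \<and> f h = g h"
    for m :: "nat \<Rightarrow>\<^sub>0 nat"
  proof -
    have pow: "\<exists>h. rat_fun h = Fract (Poly_Mapping.single (Poly_Mapping.single i k) 1) 1 \<and> f h = g h"
      for i k
    proof (induction k)
      case 0
      show ?case
        by (rule exI[of _ 1]) (simp add: f_ops g_ops one_qplus.rep_eq One_fract_def)
    next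
      case (Suc k)
      then obtain h where "rat_fun h = Fract (Poly_Mapping.single (Poly_Mapping.single i k) 1) 1"
        "f h = g h" by blast
      then show ?case
        by (intro exI[of _ "yvar i * h"])
          (simp add: f_ops g_ops eq times_qplus.rep_eq yvar.rep_eq mvar_def mult_single
             flip: single_add)
    qed
    have "\<exists>h. rat_fun h = Fract (Poly_Mapping.single (\<Sum>i\<in>I. Poly_Mapping.single i (Poly_Mapping.lookup m i)) 1) 1
              \<and> f h = g h" if "finite I" for I
      using that
    proof induction
      case empty
      show ?case
        by (rule exI[of _ 1]) (simp add: f_ops g_ops one_qplus.rep_eq One_fract_def)
    next
      case (insert i I)
      then obtain h where
        h: "rat_fun h = Fract (Poly_Mapping.single (\<Sum>i\<in>I. Poly_Mapping.single i (Poly_Mapping.lookup m i)) 1) 1"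
          "f h = g h" by blast
      obtain h' where
        h': "rat_fun h' = Fract (Poly_Mapping.single (Poly_Mapping.single i (Poly_Mapping.lookup m i)) 1) 1"
          "f h' = g h'" using pow by blast
      show ?case
        using insert.hyps h h'
        by (intro exI[of _ "h' * h"]) (simp add: f_ops g_ops times_qplus.rep_eq mult_single)
    qed
    from this[of "Poly_Mapping.keys m"] show ?thesis
      by (simp flip: mpoly_eq_sum_single)
  qed
  have scaled: "\<exists>h. rat_fun h = Fract (Poly_Mapping.single m (int (Suc c))) 1 \<and> f h = g h" for m c
  proof (induction c)
    case 0
    show ?case using monom[of m] by simp
  next
    case (Suc c)
    then obtain h where h: "rat_fun h = Fract (Poly_Mapping.single m (int (Suc c))) 1" "f h = g h"
      by blast
    obtain h' where h': "rat_fun h' = Fract (Poly_Mapping.single m 1) 1" "f h' = g h'"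
      using monom by blast
    have "Poly_Mapping.single m 1 + Poly_Mapping.single m (int (Suc c)) =
          Poly_Mapping.single m (int (Suc (Suc c)))"
      by (simp flip: single_add)
    then show ?case
      using h h'
      by (intro exI[of _ "h' + h"]) (simp add: f_ops g_ops plus_qplus.rep_eq)
  qed
  have poly: "\<exists>h. rat_fun h = Fract p 1 \<and> f h = g h" if p: "nonneg_poly p" for p
  proof -
    have scaled': "\<exists>h. rat_fun h = Fract (Poly_Mapping.single m (Poly_Mapping.lookup p m)) 1 \<and> f h = g h"
      if "m \<in> Poly_Mapping.keys p" for m
    proof -
      have "0 < Poly_Mapping.lookup p m"
        using that p by (simp add: nonneg_poly_def in_keys_iff order_less_le)
      then have "Poly_Mapping.lookup p m = int (Suc (nat (Poly_Mapping.lookup p m - 1)))" by simp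
      then show ?thesis using scaled[of m] by metis
    qed
    have "\<exists>h. rat_fun h = Fract (\<Sum>m\<in>I. Poly_Mapping.single m (Poly_Mapping.lookup p m)) 1 \<and> f h = g h"
      if "finite I" "I \<noteq> {}" "I \<subseteq> Poly_Mapping.keys p" for I
      using that
    proof (induction rule: finite_ne_induct)
      case (singleton m)
      then show ?case using scaled'[of m] by simp
    next
      case (insert m I)
      then obtain h where h: "rat_fun h = Fract (\<Sum>m\<in>I. Poly_Mapping.single m (Poly_Mapping.lookup p m)) 1"
        "f h = g h" by blast
      obtain h' where h': "rat_fun h' = Fract (Poly_Mapping.single m (Poly_Mapping.lookup p m)) 1"
        "f h' = g h'" using scaled'[of m] insert.prems by blast
      show ?case
        using insert.hyps h h'
        by (intro exI[of _ "h' + h"]) (simp add: f_ops g_ops plus_qplus.rep_eq)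
    qed
    from this[of "Poly_Mapping.keys p"] show ?thesis
      using nonneg_poly_nonzero[OF p] by (simp flip: mpoly_eq_sum_single)
  qed
  fix a
  obtain p q where pq: "rat_fun a = Fract p q" "nonneg_poly p" "nonneg_poly q"
    using rat_fun[of a] by blast
  obtain u where u: "rat_fun u = Fract p 1" "f u = g u" using poly[OF pq(2)] by blast
  obtain v where v: "rat_fun v = Fract q 1" "f v = g v" using poly[OF pq(3)] by blast
  have "a = u * inverse v"
    using u v pq
    by (simp add: rat_fun_inject[symmetric] times_qplus.rep_eq inverse_qplus.rep_eq)
  then show "f a = g a"
    using u v by (simp add: f_ops g_ops semifield_hom_inverse[OF f] semifield_hom_inverse[OF g])
qed

definition min_exp :: "int mpoly \<Rightarrow> nat \<Rightarrow> int" where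
  "min_exp p i = int (Min ((\<lambda>m. Poly_Mapping.lookup m i) ` Poly_Mapping.keys p))"

lemma min_exp_mult:
  assumes p: "nonneg_poly p" and q: "nonneg_poly q"
  shows "min_exp (p * q) i = min_exp p i + min_exp q i"
proof -
  let ?e = "\<lambda>m. Poly_Mapping.lookup (m :: nat \<Rightarrow>\<^sub>0 nat) i"
  have ne: "Poly_Mapping.keys p \<noteq> {}" "Poly_Mapping.keys q \<noteq> {}"
    using p q by (auto simp: nonneg_poly_nonzero)
  have "Min (?e ` Poly_Mapping.keys (p * q)) =
        Min (?e ` Poly_Mapping.keys p) + Min (?e ` Poly_Mapping.keys q)"
  proof (rule Min_eqI)
    show "finite (?e ` Poly_Mapping.keys (p * q))" by simp
  next
    fix z assume "z \<in> ?e ` Poly_Mapping.keys (p * q)"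
    then obtain a b where "a \<in> Poly_Mapping.keys p" "b \<in> Poly_Mapping.keys q" "z = ?e a + ?e b"
      by (auto simp: nonneg_poly_mult_aux(1)[OF p q] lookup_add)
    then show "Min (?e ` Poly_Mapping.keys p) + Min (?e ` Poly_Mapping.keys q) \<le> z"
      by (simp add: add_mono)
  next
    obtain a where a: "a \<in> Poly_Mapping.keys p" "Min (?e ` Poly_Mapping.keys p) = ?e a"
    proof -
      have "Min (?e ` Poly_Mapping.keys p) \<in> ?e ` Poly_Mapping.keys p"
        using ne by (intro Min_in finite_imageI finite_keys) blast+
      then show ?thesis using that by (rule imageE)
    qed
    obtain b where b: "b \<in> Poly_Mapping.keys q" "Min (?e ` Poly_Mapping.keys q) = ?e b"
    proof -
      have "Min (?e ` Poly_Mapping.keys q) \<in> ?e ` Poly_Mapping.keys q"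
        using ne by (intro Min_in finite_imageI finite_keys) blast+
      then show ?thesis using that by (rule imageE)
    qed
    have "a + b \<in> Poly_Mapping.keys (p * q)"
      using a b by (auto simp: nonneg_poly_mult_aux(1)[OF p q])
    then have "?e (a + b) \<in> ?e ` Poly_Mapping.keys (p * q)" by (rule imageI)
    then show "Min (?e ` Poly_Mapping.keys p) + Min (?e ` Poly_Mapping.keys q)
        \<in> ?e ` Poly_Mapping.keys (p * q)"
      by (simp add: a b lookup_add)
  qed
  then show ?thesis by (simp add: min_exp_def)
qed

lemma min_exp_add:
  assumes p: "nonneg_poly p" and q: "nonneg_poly q"
  shows "min_exp (p + q) i = min (min_exp p i) (min_exp q i)"
proof -
  have "Poly_Mapping.keys p \<noteq> {}" "Poly_Mapping.keys q \<noteq> {}"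
    using p q by (auto simp: nonneg_poly_nonzero)
  then show ?thesis
    by (simp add: min_exp_def nonneg_poly_keys_add[OF p q] image_Un Min_Un min_def)
qed

lemma min_exp_finite:
  assumes p: "nonneg_poly p"
  shows "finite {i. min_exp p i \<noteq> 0}"
proof -
  obtain m where m: "m \<in> Poly_Mapping.keys p"
    using nonneg_poly_nonzero[OF p] by fastforce
  have "i \<in> Poly_Mapping.keys m" if "min_exp p i \<noteq> 0" for i
  proof (rule ccontr)
    assume "i \<notin> Poly_Mapping.keys m"
    then have "Min ((\<lambda>m. Poly_Mapping.lookup m i) ` Poly_Mapping.keys p) \<le> 0"
      using m by (intro Min_le) (auto simp: in_keys_iff image_iff intro!: bexI[of _ m])
    then show False using that by (simp add: min_exp_def)
  qed
  then have "{i. min_exp p i \<noteq> 0} \<subseteq> Poly_Mapping.keys m" by blast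
  then show ?thesis by (rule finite_subset) simp
qed

lemma qplus_trop_hom_exists:
  "\<exists>f. semifield_hom UNIV UNIV f \<and> (\<forall>i. f (yvar i) = trop_var i)"
proof -
  have "\<exists>t. \<forall>p q. nonneg_poly p \<longrightarrow> nonneg_poly q \<longrightarrow> rat_fun a = Fract p q \<longrightarrow>
          trop_exponent t = (\<lambda>i. min_exp p i - min_exp q i)" for a
  proof -
    obtain p q where pq: "rat_fun a = Fract p q" "nonneg_poly p" "nonneg_poly q"
      using rat_fun[of a] by blast
    let ?e = "\<lambda>i. min_exp p i - min_exp q i"
    have "finite ({i. min_exp p i \<noteq> 0} \<union> {i. min_exp q i \<noteq> 0})"
      using pq by (simp add: min_exp_finite)
    then have fin: "finite {i. ?e i \<noteq> 0}" by (rule rev_finite_subset) auto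
    have "?e = (\<lambda>i. min_exp p' i - min_exp q' i)"
      if "nonneg_poly p'" "nonneg_poly q'" "rat_fun a = Fract p' q'" for p' q'
    proof
      fix i
      have "p * q' = p' * q"
        using that pq by (simp add: eq_fract nonneg_poly_nonzero)
      then have "min_exp (p * q') i = min_exp (p' * q) i" by simp
      then show "?e i = min_exp p' i - min_exp q' i"
        using that pq by (simp add: min_exp_mult)
    qed
    moreover have "trop_exponent (Abs_trop ?e) = ?e"
      by (intro Abs_trop_inverse CollectI fin)
    ultimately show ?thesis
      by (intro exI[of _ "Abs_trop ?e"] allI impI) (simp only:)
  qed
  then obtain f where f: "\<And>a p q. nonneg_poly p \<Longrightarrow> nonneg_poly q \<Longrightarrow> rat_fun a = Fract p q \<Longrightarrow>
      trop_exponent (f a) = (\<lambda>i. min_exp p i - min_exp q i)"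
    by metis
  have "f (a + b) = f a + f b \<and> f (a * b) = f a * f b" for a b
  proof -
    obtain p q where a: "rat_fun a = Fract p q" "nonneg_poly p" "nonneg_poly q"
      using rat_fun[of a] by blast
    obtain r s where b: "rat_fun b = Fract r s" "nonneg_poly r" "nonneg_poly s"
      using rat_fun[of b] by blast
    have "rat_fun (a + b) = Fract (p * s + r * q) (q * s)" "rat_fun (a * b) = Fract (p * r) (q * s)"
      using a b by (simp_all add: plus_qplus.rep_eq times_qplus.rep_eq nonneg_poly_nonzero)
    then have e: "trop_exponent (f (a + b)) = (\<lambda>i. min_exp (p * s + r * q) i - min_exp (q * s) i)"
      "trop_exponent (f (a * b)) = (\<lambda>i. min_exp (p * r) i - min_exp (q * s) i)"
      using a b by (auto intro!: f nonneg_poly_add nonneg_poly_mult)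
    show ?thesis
      using a b
      by (simp add: trop_exponent_inject[symmetric] e f[OF a(2,3,1)] f[OF b(2,3,1)]
          plus_trop.rep_eq times_trop.rep_eq min_exp_add min_exp_mult nonneg_poly_mult
          fun_eq_iff min_def)
  qed
  moreover have "f (yvar i) = trop_var i" for i
  proof -
    have "trop_exponent (f (yvar i)) = (\<lambda>j. min_exp (mvar i) j - min_exp 1 j)"
      by (rule f) (simp_all add: yvar.rep_eq)
    also have "\<dots> = trop_exponent (trop_var i)"
      by (auto simp: trop_var.rep_eq min_exp_def mvar_def fun_eq_iff lookup_single when_def
          keys_one)
    finally show ?thesis by (simp only: trop_exponent_inject)
  qed
  ultimately show ?thesis by (auto simp: semifield_hom_def)
qed

definition pi_trop :: "qplus \<Rightarrow> trop" where
  "pi_trop = (THE f. semifield_hom UNIV UNIV f \<and> (\<forall>i. f (yvar i) = trop_var i))"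

lemma pi_trop: "semifield_hom UNIV UNIV pi_trop" "pi_trop (yvar i) = trop_var i"
proof -
  have "\<exists>!f. semifield_hom UNIV UNIV f \<and> (\<forall>i. f (yvar i) = trop_var i)"
    using qplus_trop_hom_exists by (rule ex_ex1I) (auto intro: qplus_hom_unique)
  from theI'[OF this] show "semifield_hom UNIV UNIV pi_trop" "pi_trop (yvar i) = trop_var i"
    by (auto simp: pi_trop_def)
qed

text \<open>
  Every \<open>y\<close>-variable has a nonzero \<open>c\<close>-vector whose components are all nonnegative or all
  nonpositive (sign-coherence), so on \<open>y\<close>-variables the value \<open>-1\<close> means nonpositive.
\<close>

definition tropical_sign :: "nat \<Rightarrow> qplus \<Rightarrow> int" where
  "tropical_sign n f = (if \<forall>j<n. 0 \<le> trop_exponent (pi_trop f) j then 1 else - 1)"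


section \<open>Dilogarithm identities\<close>

definition rogers_L :: "real \<Rightarrow> real" where
  "rogers_L x = 1 / 2 * integral {0..x} (\<lambda>y. ln (1 + y) / y - ln y / (1 + y))"

text \<open>The seeds of the sequence with coefficients in \<open>\<rat>\<^sub>+(y)\<close> and of its specialization.\<close>

definition qseed :: "nat \<Rightarrow> (nat \<Rightarrow> nat \<Rightarrow> int) \<Rightarrow> (nat \<Rightarrow> nat) \<Rightarrow> nat \<Rightarrow> qplus seed" where
  "qseed n B k = seed_seq n k (initial_seed B yvar)"

definition tseed :: "nat \<Rightarrow> (nat \<Rightarrow> nat \<Rightarrow> int) \<Rightarrow> (nat \<Rightarrow> nat) \<Rightarrow> nat \<Rightarrow> unit seed" where
  "tseed n B k = seed_seq n k (initial_seed B (\<lambda>_. 1))"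

definition tropical_sign_seq ::
    "nat \<Rightarrow> (nat \<Rightarrow> nat \<Rightarrow> int) \<Rightarrow> (nat \<Rightarrow> nat) \<Rightarrow> nat \<Rightarrow> int" where
  "tropical_sign_seq n B k s = tropical_sign n (coef (qseed n B k s) (k s))"

definition periodic_mutation_data ::
    "nat \<Rightarrow> (nat \<Rightarrow> nat \<Rightarrow> int) \<Rightarrow> nat \<Rightarrow> (nat \<Rightarrow> nat) \<Rightarrow> (nat \<Rightarrow> nat) \<Rightarrow> (nat \<Rightarrow> int) \<Rightarrow> bool" where
  "periodic_mutation_data n B T k \<sigma> d \<longleftrightarrow>
     n \<ge> 1 \<and> skew_symmetrizable n B \<and> (\<forall>s<T. k s < n) \<and> \<sigma> permutes {..<n} \<and>
     sigma_periodic n \<sigma> (qseed n B k 0) (qseed n B k T) \<and> skew_symmetrizer n d B"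

definition x_dilogarithm_identities :: bool where
  "x_dilogarithm_identities \<longleftrightarrow>
     (\<forall>n B T k \<sigma> d. periodic_mutation_data n B T k \<sigma> d \<longrightarrow>
       (\<forall>ev. semifield_hom (gen_semifield (xvar ` {..<n})) {0::real<..} ev \<longrightarrow>
         (\<Sum>s<T. real_of_int (tropical_sign_seq n B k s) / real_of_int (d (k s)) *
            rogers_L (ev (\<Prod>j<n. clus (tseed n B k s) j powi exch (tseed n B k s) j (k s))
                        powi tropical_sign_seq n B k s)) = 0))"

definition y_dilogarithm_identities :: bool where
  "y_dilogarithm_identities \<longleftrightarrow>
     (\<forall>n B T k \<sigma> d. periodic_mutation_data n B T k \<sigma> d \<longrightarrow>
       (\<forall>ev. semifield_hom (qplus_vars n) {0::real<..} ev \<longrightarrow>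
         (\<Sum>s<T. real_of_int (tropical_sign_seq n B k s) / real_of_int (d (k s)) *
            rogers_L (ev (coef (qseed n B k s) (k s)) powi tropical_sign_seq n B k s)) = 0))"

end

theory Submission
  imports Defs "HOL-Real_Asymp.Real_Asymp"
begin

text \<open>
  Write \<open>Y\<^sub>i\<close> for the hatted variables \<open>y\<^sub>i \<Prod>\<^sub>j x\<^sub>j\<^bsup>b\<^sub>j\<^sub>i\<^esup>\<close>.  They mutate by the
  same formula as the \<open>y\<^sub>i\<close>, so \<open>Y\<^sub>i[s]\<close> at a point takes the value of \<open>y\<^sub>i[s]\<close> at \<open>y = Y[0]\<close>
  (\<open>log_coef_seed_seq\<close>, \<open>log_yhat_seed_seq\<close>).  Hence \<open>y_dilogarithm_identities\<close> implies
  \<open>x_dilogarithm_identities\<close>.  The converse does not follow in this way, because the points \<open>Y[0]\<close>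
  need not fill the positive orthant: \<open>B\<close> may be singular.  But \<open>x = 1\<close> gives \<open>Y[0] = 1\<close>, so
  the identities in \<open>x\<close> always yield those in \<open>y\<close> at the point \<open>y = (1, \<dots>, 1)\<close>, and it is enough
  that the sum is constant along each ray \<open>r \<mapsto> (t\<^sub>1\<^sup>r, \<dots>, t\<^sub>n\<^sup>r)\<close> (\<open>dilog_sum_const_on_ray\<close>).

  To see this, let \<open>\<theta>\<close> be the evaluation of \<open>\<rat>\<^sub>+(y)\<close> at \<open>t\<close>.  The ambient field only sees the
  multiplicative group of the semifield of coefficients, so for every real \<open>r\<close> there is an evaluation
  of cluster variables that sends each coefficient \<open>p\<close> to \<open>\<theta>(p)\<^sup>r\<close> and each initial \<open>x\<^sub>i\<close> to \<open>1\<close>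
  (\<open>ambient_hom_exists\<close>).  Under it, let \<open>z\<^sub>i\<close>, \<open>f\<^sub>i\<close>, \<open>w\<^sub>i = z\<^sub>i + \<Sum>\<^sub>j b\<^sub>j\<^sub>i f\<^sub>j\<close> be the
  logarithms of \<open>y\<^sub>i[s]\<close>, \<open>x\<^sub>i[s]\<close>, \<open>Y\<^sub>i[s]\<close>, let \<open>m\<close> be that of the coefficient
  \<open>1 \<oplus> y\<^sub>k[s]\<close>, and let \<open>l = log (1 + e\<^bsup>w\<^sub>k\<^esup>)\<close>; all are functions of \<open>r\<close>.  Then
  \<open>w[s]\<close> is the logarithm of the \<open>y\<close>-variables started at \<open>t\<^sup>r\<close>.  With
  \<open>u \<and> v = u v' - u' v\<close>, the expression \<open>V[s] = \<Sum>\<^sub>i (1/d\<^sub>i) f\<^sub>i \<and> (z\<^sub>i + w\<^sub>i)\<close> satisfies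
  \<open>V[s+1] - V[s] = (2/d\<^sub>k) (m \<and> z\<^sub>k - l \<and> w\<^sub>k)\<close> (\<open>pairing_step\<close>).  The first term vanishes since
  \<open>m\<close> and \<open>z\<^sub>k\<close> are both linear in \<open>r\<close>, and \<open>l \<and> w\<^sub>k\<close> is twice the derivative of
  \<open>\<epsilon> L(e\<^bsup>\<epsilon> w\<^sub>k\<^esup>)\<close> for either sign \<open>\<epsilon>\<close> (\<open>signed_rogers_L_jet\<close>).  So the derivative of the
  dilogarithm sum is \<open>(V[0] - V[T]) / 4\<close>.  This is zero: \<open>f[0] = 0\<close> as the initial cluster variables
  are evaluated at \<open>1\<close>, and then \<open>f[T] = 0\<close> by periodicity.
\<close>

section \<open>Mutation in logarithmic coordinates\<close>

text \<open>
  The steps act on functions with values in a real vector space because they are used twice: for real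
  numbers, and for pairs consisting of a value and a derivative.  The parameter \<open>m\<close> of \<open>coef_step\<close>
  stands for the logarithm of \<open>1 \<oplus> y\<^sub>k\<close>, and \<open>c\<close> in \<open>clus_step\<close> for the logarithm of
  \<open>(1 + Y\<^sub>k) / (1 \<oplus> y\<^sub>k)\<close>, where \<open>Y\<^sub>k\<close> is the hatted variable, with logarithm \<open>hat_log\<close>.
\<close>

definition exch_step :: "(nat \<Rightarrow> nat \<Rightarrow> int) \<Rightarrow> nat \<Rightarrow> nat \<Rightarrow> nat \<Rightarrow> int" where
  "exch_step b k i j = (if i = k \<or> j = k then - b i j
                     else b i j + pos_part (- b i k) * b k j + b i k * pos_part (b k j))"

definition coef_step :: "(nat \<Rightarrow> nat \<Rightarrow> int) \<Rightarrow> nat \<Rightarrow> 'v::real_vector \<Rightarrow> (nat \<Rightarrow> 'v) \<Rightarrow> nat \<Rightarrow> 'v" where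
  "coef_step b k m z i = (if i = k then - z k else
     z i + real_of_int (pos_part (b k i)) *\<^sub>R z k - real_of_int (b k i) *\<^sub>R m)"

definition clus_step ::
    "nat \<Rightarrow> (nat \<Rightarrow> nat \<Rightarrow> int) \<Rightarrow> nat \<Rightarrow> 'v::real_vector \<Rightarrow> (nat \<Rightarrow> 'v) \<Rightarrow> nat \<Rightarrow> 'v" where
  "clus_step n b k c f i = (if i = k then
     - f k + (\<Sum>j<n. real_of_int (pos_part (- b j k)) *\<^sub>R f j) + c else f i)"

definition hat_log ::
    "nat \<Rightarrow> (nat \<Rightarrow> nat \<Rightarrow> int) \<Rightarrow> (nat \<Rightarrow> 'v::real_vector) \<Rightarrow> (nat \<Rightarrow> 'v) \<Rightarrow> nat \<Rightarrow> 'v" where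
  "hat_log n b z f i = z i + (\<Sum>j<n. real_of_int (b j i) *\<^sub>R f j)"

text \<open>
  The hatted variables mutate like coefficients, with \<open>l\<close> in place of \<open>m\<close>: the factor \<open>1 \<oplus> y\<^sub>k\<close>
  that \<open>y\<^sub>i\<close> gains is cancelled by the one in the denominator of \<open>x\<^sub>k\<close>.
\<close>

lemma hat_log_step:
  assumes k: "k < n" and bkk: "b k k = 0"
  shows "hat_log n (exch_step b k) (coef_step b k m z) (clus_step n b k (l - m) f) i =
         coef_step b k l (hat_log n b z f) i"
proof -
  define s where "s = (\<Sum>j<n. real_of_int (pos_part (- b j k)) *\<^sub>R f j)"
  have split: "(\<Sum>j<n. g j) = g k + (\<Sum>j\<in>{..<n} - {k}. g j)" for g :: "nat \<Rightarrow> 'a"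
    using k by (simp add: sum.remove)
  have s: "s = (\<Sum>j\<in>{..<n} - {k}. real_of_int (pos_part (- b j k)) *\<^sub>R f j)"
    unfolding s_def by (subst split) (simp add: bkk)
  show ?thesis
  proof (cases "i = k")
    case True
    have "(\<Sum>j\<in>{..<n} - {k}. real_of_int (exch_step b k j k) *\<^sub>R clus_step n b k (l - m) f j) =
        - (\<Sum>j\<in>{..<n} - {k}. real_of_int (b j k) *\<^sub>R f j)"
      by (simp add: exch_step_def clus_step_def sum_negf[symmetric])
    then show ?thesis
      unfolding True by (simp add: hat_log_def coef_step_def split bkk exch_step_def)
  next
    case False
    have 1: "(\<Sum>j\<in>{..<n} - {k}. real_of_int (exch_step b k j i) *\<^sub>R clus_step n b k (l - m) f j) =
      (\<Sum>j\<in>{..<n} - {k}. real_of_int (b j i) *\<^sub>R f j) + real_of_int (b k i) *\<^sub>R s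
       + real_of_int (pos_part (b k i)) *\<^sub>R (\<Sum>j\<in>{..<n} - {k}. real_of_int (b j k) *\<^sub>R f j)"
      unfolding s scaleR_sum_right sum.distrib[symmetric]
      by (rule sum.cong) (use False in \<open>auto simp: exch_step_def clus_step_def scaleR_add_left mult.commute\<close>)
    have 2: "clus_step n b k (l - m) f k = - f k + s + (l - m)"
      by (simp add: clus_step_def s_def)
    have 3: "exch_step b k k i = - b k i"
      by (simp add: exch_step_def)
    show ?thesis
      using False
      by (simp add: hat_log_def split[of "\<lambda>j. _ j *\<^sub>R _ j"] 1 2 3)
         (simp add: coef_step_def hat_log_def bkk split algebra_simps)
  qed
qed

lemma skew_symmetrizer_diag: "skew_symmetrizer n d b \<Longrightarrow> k < n \<Longrightarrow> b k k = 0"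
  unfolding skew_symmetrizer_def by (metis equal_neg_zero less_irrefl minus_mult_left mult_eq_0_iff)

lemma skew_symmetrizer_step:
  assumes d: "skew_symmetrizer n d b" and k: "k < n"
  shows "skew_symmetrizer n d (exch_step b k)"
  unfolding skew_symmetrizer_def
proof (intro conjI allI impI)
  show "0 < d i" if "i < n" for i using d that by (simp add: skew_symmetrizer_def)
  have pos: "d i * pos_part a = pos_part (d i * a)" if "i < n" for i a
  proof -
    have "0 < d i" using d that by (simp add: skew_symmetrizer_def)
    then show ?thesis using max_mult_distrib_left[of "d i" a 0] by simp
  qed
  have sk: "d i * b i j = - d j * b j i" if "i < n" "j < n" for i j
    using d that unfolding skew_symmetrizer_def by blast
  fix i j assume ij: "i < n" "j < n"
  show "d i * exch_step b k i j = - d j * exch_step b k j i"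
  proof (cases "i = k \<or> j = k")
    case True
    then show ?thesis using sk[OF ij] by (auto simp: exch_step_def)
  next
    case False
    have "d i * pos_part (- b i k) = d k * pos_part (b k i)"
      "d j * pos_part (- b j k) = d k * pos_part (b k j)"
      using sk[of i k] sk[of j k] ij k by (simp_all add: pos)
    then have P: "d i * pos_part (- b i k) * b k j = pos_part (b k i) * (d k * b k j)"
      "d k * pos_part (b k j) * b k i = d j * pos_part (- b j k) * b k i"
      by (simp_all add: mult_ac)
    have "d i * exch_step b k i j =
        d i * b i j + d i * pos_part (- b i k) * b k j + (d i * b i k) * pos_part (b k j)"
      using False by (simp add: exch_step_def algebra_simps)
    also have "\<dots> = - d j * b j i - d j * b j k * pos_part (b k i)
        - d k * pos_part (b k j) * b k i"
      unfolding P(1) using sk[of i j] sk[of k j] sk[of i k] ij k by (simp add: mult_ac)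
    also have "\<dots> = - d j * exch_step b k j i"
      unfolding P(2) using False by (simp add: exch_step_def algebra_simps)
    finally show ?thesis .
  qed
qed

text \<open>
  For an alternating \<open>W\<close> and the hatted logarithms \<open>w\<close> of \<open>z\<close> and \<open>f\<close> this is \<open>2 \<Sum>\<^sub>i (1/d\<^sub>i) W(f\<^sub>i, z\<^sub>i)\<close> plus the term
  \<open>\<Sum>\<^sub>i\<^sub>j (b\<^sub>j\<^sub>i/d\<^sub>i) W(f\<^sub>i, f\<^sub>j)\<close> of the familiar skew form of the exchange matrix.
\<close>

definition pairing ::
    "('v \<Rightarrow> 'v \<Rightarrow> real) \<Rightarrow> nat \<Rightarrow> (nat \<Rightarrow> int) \<Rightarrow> (nat \<Rightarrow> 'v::real_vector) \<Rightarrow> (nat \<Rightarrow> 'v) \<Rightarrow> (nat \<Rightarrow> 'v) \<Rightarrow> real" where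
  "pairing W n d f z w = (\<Sum>i<n. W (f i) (z i + w i) / real_of_int (d i))"

text \<open>
  Since \<open>b\<^sub>k\<^sub>i/d\<^sub>i = - b\<^sub>i\<^sub>k/d\<^sub>k\<close>, the monomial \<open>\<Prod>\<^sub>j x\<^sub>j\<close> to the powers
  \<open>max (- b\<^sub>j\<^sub>k) 0\<close> in the new \<open>x\<^sub>k\<close> contributes the opposite of what the monomials in \<open>y\<^sub>k\<close> in the new
  \<open>y\<^sub>i\<close> contribute.  What remains is \<open>W (m - l) (z\<^sub>k + w\<^sub>k)\<close> from index \<open>k\<close> and
  \<open>W (w\<^sub>k - z\<^sub>k) (l + m)\<close> from the other indices, where the terms pairing \<open>m\<close> with \<open>w\<^sub>k\<close> and \<open>l\<close> with \<open>z\<^sub>k\<close> cancel.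
\<close>

lemma pairing_step:
  fixes W :: "'v::real_vector \<Rightarrow> 'v \<Rightarrow> real"
  assumes W: "bilinear W" and alt: "\<And>u v. W u v = - W v u"
    and d: "skew_symmetrizer n d b" and k: "k < n"
    and w: "w = hat_log n b z f"
  shows "pairing W n d (clus_step n b k (l - m) f) (coef_step b k m z) (coef_step b k l w) =
         pairing W n d f z w + 2 * (W m (z k) - W l (w k)) / real_of_int (d k)"
proof -
  note lin = bilinear_ladd[OF W] bilinear_radd[OF W] bilinear_lsub[OF W] bilinear_rsub[OF W]
    bilinear_lmul[OF W] bilinear_rmul[OF W] bilinear_lneg[OF W] bilinear_rneg[OF W]
  have Wsum: "W (\<Sum>j\<in>A. g j) v = (\<Sum>j\<in>A. W (g j) v)" for g v and A :: "nat set"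
    using W linear_sum[of "\<lambda>x. W x v"] by (simp add: bilinear_def)
  have dpos: "real_of_int (d i) > 0" if "i < n" for i
    using d that by (simp add: skew_symmetrizer_def)
  have bkk: "b k k = 0" using skew_symmetrizer_diag[OF d k] .
  have sk: "real_of_int (b k i) / d i = - real_of_int (b i k) / d k" if "i < n" for i
  proof -
    have "d k * b k i = - d i * b i k" using d k that unfolding skew_symmetrizer_def by blast
    then have "real_of_int (d k) * b k i = - real_of_int (d i) * b i k"
      by (metis of_int_minus of_int_mult)
    then show ?thesis using dpos[OF that] dpos[OF k] by (simp add: field_simps)
  qed
  have skp: "real_of_int (pos_part (b k i)) / d i = real_of_int (pos_part (- b i k)) / d k" if "i < n" for i
  proof -
    have "real_of_int (pos_part (b k i)) / d i = max (real_of_int (b k i) / d i) 0"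
      using dpos[OF that] by (auto simp: max_def divide_le_0_iff)
    also have "\<dots> = real_of_int (pos_part (- b i k)) / d k"
      unfolding sk[OF that] using dpos[OF k] by (auto simp: max_def field_simps)
    finally show ?thesis .
  qed
  let ?u = "z k + w k"
  let ?N = "{..<n} - {k}"
  have split: "(\<Sum>j<n. g j) = g k + (\<Sum>j\<in>?N. g j)" for g :: "nat \<Rightarrow> real"
    using k by (simp add: sum.remove)
  have summand: "W (clus_step n b k (l - m) f i) (coef_step b k m z i + coef_step b k l w i) / d i
      = W (f i) (z i + w i) / d i + real_of_int (pos_part (- b i k)) * W (f i) ?u / d k
        + real_of_int (b i k) * W (f i) (l + m) / d k" if "i \<in> ?N" for i
  proof -
    have i: "i < n" "i \<noteq> k" using that by auto
    have "W (clus_step n b k (l - m) f i) (coef_step b k m z i + coef_step b k l w i) / d i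
      = W (f i) (z i + w i) / d i + (real_of_int (pos_part (b k i)) / d i) * W (f i) ?u
        - (real_of_int (b k i) / d i) * W (f i) (l + m)"
      using i by (simp add: clus_step_def coef_step_def lin algebra_simps add_divide_distrib diff_divide_distrib)
    then show ?thesis unfolding sk[OF i(1)] skp[OF i(1)] by simp
  qed
  have S: "(\<Sum>i\<in>?N. real_of_int (pos_part (- b i k)) * W (f i) ?u) =
      W (\<Sum>j<n. real_of_int (pos_part (- b j k)) *\<^sub>R f j) ?u"
    by (simp add: Wsum lin split bkk distrib_left sum.distrib)
  have wz: "(\<Sum>i\<in>?N. real_of_int (b i k) * W (f i) (l + m)) = W (w k - z k) (l + m)"
    by (simp add: w hat_log_def Wsum lin(5) split bkk)
  have "pairing W n d (clus_step n b k (l - m) f) (coef_step b k m z) (coef_step b k l w)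
     = W (f k - (\<Sum>j<n. real_of_int (pos_part (- b j k)) *\<^sub>R f j) - (l - m)) ?u / d k
       + ((\<Sum>i\<in>?N. W (f i) (z i + w i) / d i) + W (\<Sum>j<n. real_of_int (pos_part (- b j k)) *\<^sub>R f j) ?u / d k
        + W (w k - z k) (l + m) / d k)"
    unfolding pairing_def split
    by (simp only: sum.cong[OF refl summand] sum.distrib sum_divide_distrib[symmetric] S wz)
       (simp add: clus_step_def coef_step_def lin algebra_simps diff_divide_distrib add_divide_distrib)
  also have "\<dots> = pairing W n d f z w + (W (m - l) ?u + W (w k - z k) (l + m)) / d k"
    unfolding pairing_def split by (simp add: lin diff_divide_distrib add_divide_distrib)
  also have "W (m - l) ?u + W (w k - z k) (l + m) = 2 * (W m (z k) - W l (w k))"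
    using alt[of "w k" l] alt[of "w k" m] alt[of "z k" l] alt[of "z k" m] by (simp add: lin)
  finally show ?thesis .
qed

section \<open>The derivative of the Rogers dilogarithm\<close>

text \<open>
  The integrand is unbounded at \<open>0\<close>, so the integral is split as \<open>2 \<integral> g - h\<close>, where \<open>g y\<close> is
  \<open>ln (1 + y) / y\<close> continued by \<open>1\<close> at \<open>0\<close>, and \<open>h y = ln y * ln (1 + y)\<close> absorbs the singular part:
  it extends continuously to \<open>0\<close>.  With \<open>ln 0 = 0\<close>, the formula for \<open>h\<close> already takes the right value there.
\<close>

lemma rogers_L_has_derivative:
  assumes x: "x > 0"
  shows "(rogers_L has_real_derivative (ln (1 + x) / x - ln x / (1 + x)) / 2) (at x)"
proof -
  define g :: "real \<Rightarrow> real" where "g y = (if y = 0 then 1 else ln (1 + y) / y)" for y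
  have g_lim: "((\<lambda>y::real. ln (1 + y) / y) \<longlongrightarrow> 1) (at 0)"
    using DERIV_ln[of "1::real"] unfolding DERIV_def by simp
  have g_cont: "continuous_on {0..b} g" for b
    unfolding continuous_on_def
  proof
    fix a assume a: "a \<in> {0..b}"
    show "(g \<longlongrightarrow> g a) (at a within {0..b})"
    proof (cases "a = 0")
      case True
      have g0: "(g \<longlongrightarrow> 1) (at 0)"
        by (rule Lim_transform_eventually[OF g_lim]) (auto simp: g_def eventually_at_filter)
      then show ?thesis unfolding True using tendsto_within_subset[OF g0 subset_UNIV] by (simp add: g_def)
    next
      case False
      then have "a > 0" using a by simp
      have "((\<lambda>y. ln (1 + y) / y) \<longlongrightarrow> g a) (at a within {0..b})"
        unfolding g_def using \<open>a > 0\<close> by (auto intro!: tendsto_eq_intros)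
      moreover have "eventually (\<lambda>y. y \<noteq> 0) (at a within {0..b})"
        using \<open>a > 0\<close> by (intro eventually_neq_at_within)
      then have "eventually (\<lambda>y. ln (1 + y) / y = g y) (at a within {0..b})"
        by eventually_elim (simp add: g_def)
      ultimately show ?thesis by (rule Lim_transform_eventually)
    qed
  qed
  define h :: "real \<Rightarrow> real" where "h y = ln y * ln (1 + y)" for y
  have h_lim: "(h \<longlongrightarrow> 0) (at_right 0)"
    unfolding h_def by real_asymp
  have h_cont: "continuous_on {0..b} h" for b
    unfolding continuous_on_def
  proof
    fix a assume a: "a \<in> {0..b}"
    show "(h \<longlongrightarrow> h a) (at a within {0..b})"
    proof (cases "a = 0")
      case True
      have "(h \<longlongrightarrow> 0) (at 0 within {0..b})"
        using h_lim by (rule tendsto_mono[rotated]) (auto simp: at_within_def intro!: le_infI2)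
      then show ?thesis unfolding True by (simp add: h_def)
    next
      case False
      then have "a > 0" using a by simp
      then show ?thesis unfolding h_def by (auto intro!: tendsto_eq_intros)
    qed
  qed
  have int: "((\<lambda>y. ln (1 + y) / y - ln y / (1 + y)) has_integral 2 * integral {0..b} g - h b) {0..b}"
    if "b \<ge> 0" for b
  proof -
    have "((\<lambda>y. ln (1 + y) / y + ln y / (1 + y)) has_integral h b - h 0) {0..b}"
      using that h_cont
    proof (rule fundamental_theorem_of_calculus_interior)
      fix y assume "y \<in> {0<..<b}"
      then have "y > 0" by simp
      then show "(h has_vector_derivative ln (1 + y) / y + ln y / (1 + y)) (at y)"
        unfolding h_def has_real_derivative_iff_has_vector_derivative[symmetric]
        by (auto intro!: derivative_eq_intros simp: field_simps)
    qed
    moreover have "((\<lambda>y. 2 * g y) has_integral 2 * integral {0..b} g) {0..b}"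
      using integrable_continuous_real[OF g_cont] by (intro has_integral_mult_right integrable_integral)
    ultimately have "((\<lambda>y. 2 * g y - (ln (1 + y) / y + ln y / (1 + y))) has_integral
        2 * integral {0..b} g - (h b - h 0)) {0..b}"
      by (rule has_integral_diff[rotated])
    then have "((\<lambda>y. ln (1 + y) / y - ln y / (1 + y)) has_integral
        2 * integral {0..b} g - (h b - h 0)) {0..b}"
      by (rule has_integral_spike[OF negligible_sing[of 0], rotated]) (simp add: g_def)
    then show ?thesis by (simp add: h_def)
  qed
  have L: "rogers_L b = integral {0..b} g - h b / 2" if "b \<ge> 0" for b
    using integral_unique[OF int[OF that]] by (simp add: rogers_L_def)
  have "((\<lambda>b. integral {0..b} g) has_real_derivative g x) (at x within {0..x + 1})"
    using x by (intro integral_has_real_derivative g_cont) auto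
  then have "((\<lambda>b. integral {0..b} g) has_real_derivative g x) (at x)"
    using x by (simp add: at_within_Icc_at)
  moreover have "(h has_real_derivative ln (1 + x) / x + ln x / (1 + x)) (at x)"
    unfolding h_def using x by (auto intro!: derivative_eq_intros simp: field_simps)
  ultimately have "((\<lambda>b. integral {0..b} g - h b / 2) has_real_derivative
      g x - (ln (1 + x) / x + ln x / (1 + x)) / 2) (at x)"
    by (intro DERIV_diff DERIV_cdivide)
  then have "(rogers_L has_real_derivative g x - (ln (1 + x) / x + ln x / (1 + x)) / 2) (at x)"
    by (rule has_field_derivative_transform_within_open[of _ _ _ "{0<..}"]) (use x L in auto)
  moreover have "g x - (ln (1 + x) / x + ln x / (1 + x)) / 2 = (ln (1 + x) / x - ln x / (1 + x)) / 2"
    using x unfolding g_def by (simp only: if_False less_imp_neq[symmetric]) argo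
  ultimately show ?thesis by simp
qed

section \<open>Evaluation of positive elements\<close>

text \<open>
  An evaluation of a ring at real numbers need not extend to the fraction field, because denominators may
  evaluate to zero.  It does extend on a subsemiring whose nonzero elements have positive values, and this
  property passes to fractions and to polynomials, hence to the ambient field, which is built from the integers by
  a group ring, fractions, polynomials and fractions again.
\<close>

definition positive_eval :: "'a::comm_ring_1 set \<Rightarrow> ('a \<Rightarrow> real) \<Rightarrow> bool" where
  "positive_eval A ev \<longleftrightarrow> 0 \<in> A \<and> 1 \<in> A \<and>
     (\<forall>a\<in>A. \<forall>b\<in>A. a + b \<in> A \<and> a * b \<in> A \<and> ev (a + b) = ev a + ev b \<and> ev (a * b) = ev a * ev b) \<and>
     (\<forall>a\<in>A. a \<noteq> 0 \<longrightarrow> ev a > 0)"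

lemma positive_evalD:
  assumes "positive_eval A ev"
  shows "0 \<in> A" "1 \<in> A" "a \<in> A \<Longrightarrow> b \<in> A \<Longrightarrow> a + b \<in> A" "a \<in> A \<Longrightarrow> b \<in> A \<Longrightarrow> a * b \<in> A"
    "a \<in> A \<Longrightarrow> b \<in> A \<Longrightarrow> ev (a + b) = ev a + ev b" "a \<in> A \<Longrightarrow> b \<in> A \<Longrightarrow> ev (a * b) = ev a * ev b"
    "a \<in> A \<Longrightarrow> a \<noteq> 0 \<Longrightarrow> ev a > 0" "ev 0 = 0" "ev 1 = 1"
proof -
  show D: "0 \<in> A" "1 \<in> A" "a \<in> A \<Longrightarrow> b \<in> A \<Longrightarrow> a + b \<in> A" "a \<in> A \<Longrightarrow> b \<in> A \<Longrightarrow> a * b \<in> A"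
    "a \<in> A \<Longrightarrow> b \<in> A \<Longrightarrow> ev (a + b) = ev a + ev b" "a \<in> A \<Longrightarrow> b \<in> A \<Longrightarrow> ev (a * b) = ev a * ev b"
    "a \<in> A \<Longrightarrow> a \<noteq> 0 \<Longrightarrow> ev a > 0" for a b
    using assms unfolding positive_eval_def by blast+
  show "ev 0 = 0" using D(5)[OF D(1) D(1)] by simp
  have "ev 1 > 0" using D(7)[OF D(2)] by simp
  then show "ev 1 = 1" using D(6)[OF D(2) D(2)] by simp
qed

lemma fract_positive_eval:
  fixes A :: "'a::idom set"
  assumes ev: "positive_eval A ev"
  obtains B ev' where "positive_eval B ev'" "\<And>a b. a \<in> B \<Longrightarrow> b \<in> B \<Longrightarrow> a / b \<in> B"
    "\<And>p. p \<in> A \<Longrightarrow> Fract p 1 \<in> B \<and> ev' (Fract p 1) = ev p"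
proof -
  note D = positive_evalD[OF ev]
  let ?A = "{Fract p q | p q. p \<in> A \<and> q \<in> A \<and> q \<noteq> 0}"
  have "\<exists>r. \<forall>p q. p \<in> A \<longrightarrow> q \<in> A \<longrightarrow> q \<noteq> 0 \<longrightarrow> a = Fract p q \<longrightarrow> r = ev p / ev q" for a
  proof (cases "a \<in> ?A")
    case True
    then obtain p q where a: "a = Fract p q" "p \<in> A" "q \<in> A" "q \<noteq> 0" by blast
    have "ev p / ev q = ev p' / ev q'" if p': "p' \<in> A" "q' \<in> A" "q' \<noteq> 0" "a = Fract p' q'" for p' q'
    proof -
      have "p * q' = p' * q" using a p' by (simp add: eq_fract)
      then have "ev p * ev q' = ev p' * ev q" using a p' by (metis D(6))
      then show ?thesis using D(7)[of q] D(7)[of q'] a p' by (simp add: frac_eq_eq)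
    qed
    then show ?thesis by blast
  qed blast
  then obtain ev' where "\<forall>a p q. p \<in> A \<longrightarrow> q \<in> A \<longrightarrow> q \<noteq> 0 \<longrightarrow> a = Fract p q \<longrightarrow> ev' a = ev p / ev q"
    by metis
  then have ev': "ev' (Fract p q) = ev p / ev q" if "p \<in> A" "q \<in> A" "q \<noteq> 0" for p q
    using that by blast
  have "positive_eval ?A ev'"
    unfolding positive_eval_def
  proof (intro conjI ballI impI)
    show "0 \<in> ?A"
      using D(1,2) unfolding Zero_fract_def by (intro CollectI exI[of _ 0] exI[of _ 1]) simp
    show "1 \<in> ?A"
      using D(2) unfolding One_fract_def by (intro CollectI exI[of _ 1]) simp
  next
    fix a b assume "a \<in> ?A" "b \<in> ?A"
    then obtain p q r s where a: "a = Fract p q" "p \<in> A" "q \<in> A" "q \<noteq> 0"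
      and b: "b = Fract r s" "r \<in> A" "s \<in> A" "s \<noteq> 0" by blast
    have in_A: "p * s + r * q \<in> A" "q * s \<in> A" "p * r \<in> A" "q * s \<noteq> 0"
      using a b by (auto intro!: D(3,4))
    have ab: "a + b = Fract (p * s + r * q) (q * s)" "a * b = Fract (p * r) (q * s)"
      using a b by simp_all
    show "a + b \<in> ?A" "a * b \<in> ?A"
      unfolding ab using in_A by blast+
    have pos: "ev q > 0" "ev s > 0" using a b by (simp_all add: D(7))
    show "ev' (a + b) = ev' a + ev' b" "ev' (a * b) = ev' a * ev' b"
      unfolding ab ev'[OF in_A(1,2,4)] ev'[OF in_A(3,2,4)]
      using a b pos by (simp_all add: ev' D(3-6) field_simps)
  next
    fix a assume "a \<in> ?A" "a \<noteq> 0"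
    then obtain p q where a: "a = Fract p q" "p \<in> A" "q \<in> A" "q \<noteq> 0" by blast
    with \<open>a \<noteq> 0\<close> have "p \<noteq> 0" by (auto simp: fract_collapse)
    then show "ev' a > 0" using a by (simp add: ev' D(7))
  qed
  moreover have "a / b \<in> ?A" if ab: "a \<in> ?A" "b \<in> ?A" for a b
  proof -
    obtain p q r s where a: "a = Fract p q" "p \<in> A" "q \<in> A" "q \<noteq> 0"
      and b: "b = Fract r s" "r \<in> A" "s \<in> A" "s \<noteq> 0" using ab by blast
    show ?thesis
    proof (cases "r = 0")
      case True
      then have "a / b = 0" using b by (simp add: fract_collapse)
      then show ?thesis using positive_evalD(1)[OF \<open>positive_eval ?A ev'\<close>] by (simp only:)
    next
      case False
      have "a / b = Fract (p * s) (q * r)" using a b by simp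
      moreover have "p * s \<in> A" "q * r \<in> A" "q * r \<noteq> 0" using a b False by (simp_all add: D(4))
      ultimately show ?thesis by blast
    qed
  qed
  moreover have "Fract p 1 \<in> ?A \<and> ev' (Fract p 1) = ev p" if "p \<in> A" for p
  proof
    show "Fract p 1 \<in> ?A" using that D(2) by (intro CollectI exI[of _ p] exI[of _ 1]) simp
    show "ev' (Fract p 1) = ev p" using ev'[OF that D(2)] by (simp add: D(9))
  qed
  ultimately show thesis by (rule that)
qed

definition weighted_sum :: "('m \<Rightarrow> real) \<Rightarrow> ('a \<Rightarrow> real) \<Rightarrow> ('m \<Rightarrow>\<^sub>0 'a::zero) \<Rightarrow> real" where
  "weighted_sum \<mu> ev p = (\<Sum>m\<in>Poly_Mapping.keys p. ev (Poly_Mapping.lookup p m) * \<mu> m)"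

text \<open>
  Stated for an arbitrary monoid of exponents, so that it covers group rings as well as polynomials.
\<close>

lemma poly_positive_eval:
  fixes A :: "'a::comm_ring_1 set" and \<mu> :: "'m::comm_monoid_add \<Rightarrow> real"
  assumes ev: "positive_eval A ev"
    and \<mu>: "\<And>m. \<mu> m > 0" "\<mu> 0 = 1" "\<And>m m'. \<mu> (m + m') = \<mu> m * \<mu> m'"
  shows "positive_eval {p. \<forall>m. Poly_Mapping.lookup p m \<in> A} (weighted_sum \<mu> ev)"
proof -
  note D = positive_evalD[OF ev]
  let ?A = "{p :: 'm \<Rightarrow>\<^sub>0 'a. \<forall>m. Poly_Mapping.lookup p m \<in> A}"
  let ?ev = "weighted_sum \<mu> ev"
  have ev_super: "?ev p = (\<Sum>m\<in>K. ev (Poly_Mapping.lookup p m) * \<mu> m)"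
    if "finite K" "Poly_Mapping.keys p \<subseteq> K" for p K
    unfolding weighted_sum_def using that
    by (intro sum.mono_neutral_left) (auto simp: in_keys_iff D(8))
  have ev_single: "?ev (Poly_Mapping.single m c) = ev c * \<mu> m" for m c
    by (subst ev_super[of "{m}"]) (auto split: if_splits)
  have add: "p + q \<in> ?A \<and> ?ev (p + q) = ?ev p + ?ev q" if "p \<in> ?A" "q \<in> ?A" for p q
  proof -
    let ?K = "Poly_Mapping.keys p \<union> Poly_Mapping.keys q"
    have "?ev (p + q) = (\<Sum>m\<in>?K. ev (Poly_Mapping.lookup (p + q) m) * \<mu> m)"
      by (intro ev_super) (auto simp: Poly_Mapping.keys_add)
    also have "\<dots> = ?ev p + ?ev q"
      using that by (simp add: ev_super[of ?K] lookup_add D(5) distrib_right sum.distrib)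
    finally show ?thesis using that by (simp add: lookup_add D(3))
  qed
  have zero: "0 \<in> ?A" "?ev 0 = 0" by (simp_all add: D(1) weighted_sum_def)
  have sum: "sum g I \<in> ?A \<and> ?ev (sum g I) = (\<Sum>i\<in>I. ?ev (g i))"
    if "\<And>i. i \<in> I \<Longrightarrow> g i \<in> ?A" for g :: "'m \<Rightarrow> 'm \<Rightarrow>\<^sub>0 'a" and I
    using that
  proof (induction I rule: infinite_finite_induct)
    case (insert i I)
    then show ?case using add[of "g i" "sum g I"] by auto
  qed (use zero in simp_all)
  have mult: "p * q \<in> ?A \<and> ?ev (p * q) = ?ev p * ?ev q" if "p \<in> ?A" "q \<in> ?A" for p q
  proof -
    let ?p = "Poly_Mapping.lookup p" and ?q = "Poly_Mapping.lookup q"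
    let ?t = "\<lambda>a b. Poly_Mapping.single (a + b) (?p a * ?q b)"
    have t: "?t a b \<in> ?A" "?ev (?t a b) = (ev (?p a) * \<mu> a) * (ev (?q b) * \<mu> b)" for a b
      using that by (auto simp: ev_single lookup_single when_def D(1,4,6) \<mu>(3))
    have "p * q = (\<Sum>a\<in>Poly_Mapping.keys p. Poly_Mapping.single a (?p a)) *
                (\<Sum>b\<in>Poly_Mapping.keys q. Poly_Mapping.single b (?q b))"
      using mpoly_eq_sum_single[of p] mpoly_eq_sum_single[of q] by simp
    then have pq: "p * q = (\<Sum>a\<in>Poly_Mapping.keys p. \<Sum>b\<in>Poly_Mapping.keys q. ?t a b)"
      by (simp add: sum_product mult_single)
    have inner: "(\<Sum>b\<in>Poly_Mapping.keys q. ?t a b) \<in> ?A"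
      "?ev (\<Sum>b\<in>Poly_Mapping.keys q. ?t a b) = (ev (?p a) * \<mu> a) * ?ev q" for a
      using sum[of "Poly_Mapping.keys q" "?t a"] t
      by (simp_all add: weighted_sum_def sum_distrib_left)
    show ?thesis
      unfolding pq
      using sum[of "Poly_Mapping.keys p" "\<lambda>a. \<Sum>b\<in>Poly_Mapping.keys q. ?t a b"] inner
      by (simp add: weighted_sum_def sum_distrib_right)
  qed
  show ?thesis
    unfolding positive_eval_def
  proof (intro conjI ballI impI)
    show "1 \<in> ?A" by (simp add: lookup_one when_def D(1,2))
    fix p assume p: "p \<in> ?A" "p \<noteq> 0"
    show "?ev p > 0" unfolding weighted_sum_def
      using p by (intro sum_pos) (auto simp: in_keys_iff D(7) \<mu>(1))
  qed (use zero add mult in auto)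
qed

lemma weighted_sum_single:
  "weighted_sum \<mu> ev (Poly_Mapping.single m c) = (if c = 0 then 0 else ev c * \<mu> m)"
  by (simp add: weighted_sum_def)

definition monomial_value :: "(nat \<Rightarrow> real) \<Rightarrow> (nat \<Rightarrow>\<^sub>0 nat) \<Rightarrow> real" where
  "monomial_value u m = (\<Prod>i\<in>Poly_Mapping.keys m. u i ^ Poly_Mapping.lookup m i)"

lemma monomial_value:
  assumes "\<And>i. u i > 0"
  shows "monomial_value u m > 0" "monomial_value u 0 = 1"
    "monomial_value u (m + m') = monomial_value u m * monomial_value u m'"
    "monomial_value u (Poly_Mapping.single i 1) = u i"
proof -
  show "monomial_value u m > 0" using assms by (simp add: monomial_value_def prod_pos)
  show "monomial_value u 0 = 1" by (simp add: monomial_value_def)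
  show "monomial_value u (Poly_Mapping.single i 1) = u i" by (simp add: monomial_value_def)
  have super: "monomial_value u m = (\<Prod>i\<in>K. u i ^ Poly_Mapping.lookup m i)"
    if "finite K" "Poly_Mapping.keys m \<subseteq> K" for m K
    unfolding monomial_value_def using that
    by (intro prod.mono_neutral_left) (auto simp: in_keys_iff)
  let ?K = "Poly_Mapping.keys m \<union> Poly_Mapping.keys m'"
  show "monomial_value u (m + m') = monomial_value u m * monomial_value u m'"
    using Poly_Mapping.keys_add[of m m']
    by (simp add: super[of ?K] lookup_add power_add prod.distrib)
qed

text \<open>
  The map \<open>\<theta>\<close> has to respect products only: a sum in the semifield of coefficients is unrelated to
  sums in the ambient field.  This freedom allows \<open>\<theta>\<close> to be a real power of an evaluation.
\<close>

lemma ambient_hom_exists: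
  fixes \<theta> :: "'p::semifield \<Rightarrow> real" and u :: "nat \<Rightarrow> real"
  assumes \<theta>: "\<And>p. \<theta> p > 0" "\<And>p q. \<theta> (p * q) = \<theta> p * \<theta> q" and u: "\<And>i. u i > 0"
  shows "\<exists>ev. semifield_hom (gen_semifield (range xvar \<union> range emb) :: 'p ambient set) {0<..} ev \<and>
    (\<forall>i. ev (xvar i) = u i) \<and> (\<forall>p. ev (emb p) = \<theta> p)"
proof -
  have \<theta>1: "\<theta> 1 = 1" using \<theta>(1)[of 1] \<theta>(2)[of 1 1] by simp
  have int: "positive_eval {0::int..} real_of_int"
    by (auto simp: positive_eval_def)
  define A1 where "A1 = {p :: 'p mult_grp \<Rightarrow>\<^sub>0 int. \<forall>m. Poly_Mapping.lookup p m \<in> {0..}}"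
  define ev1 where "ev1 = weighted_sum (\<lambda>g::'p mult_grp. \<theta> (of_grp g)) real_of_int"
  have 1: "positive_eval A1 ev1"
    unfolding A1_def ev1_def
    by (rule poly_positive_eval[OF int])
      (simp_all add: \<theta> \<theta>1 zero_mult_grp.rep_eq plus_mult_grp.rep_eq)
  obtain A2 ev2 where 2: "positive_eval A2 ev2" and div2: "\<And>a b. a \<in> A2 \<Longrightarrow> b \<in> A2 \<Longrightarrow> a / b \<in> A2"
    and ev2: "\<And>p. p \<in> A1 \<Longrightarrow> Fract p 1 \<in> A2 \<and> ev2 (Fract p 1) = ev1 p"
    by (rule fract_positive_eval[OF 1]) (rule that)
  define A3 where "A3 = {p :: 'p coeff_field mpoly. \<forall>m. Poly_Mapping.lookup p m \<in> A2}"
  define ev3 where "ev3 = weighted_sum (monomial_value u) ev2"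
  have 3: "positive_eval A3 ev3"
    unfolding A3_def ev3_def
    by (rule poly_positive_eval[OF 2]) (simp_all add: monomial_value[OF u])
  obtain A4 ev4 where 4: "positive_eval A4 ev4" and div4: "\<And>a b. a \<in> A4 \<Longrightarrow> b \<in> A4 \<Longrightarrow> a / b \<in> A4"
    and ev4: "\<And>p. p \<in> A3 \<Longrightarrow> Fract p 1 \<in> A4 \<and> ev4 (Fract p 1) = ev3 p"
    by (rule fract_positive_eval[OF 3]) (rule that)
  note D2 = positive_evalD[OF 2] and D4 = positive_evalD[OF 4]
  have xvar: "xvar i \<in> A4" "ev4 (xvar i) = u i" for i
  proof -
    have "(mvar i :: 'p coeff_field mpoly) \<in> A3"
      by (simp add: A3_def mvar_def lookup_single when_def D2(1,2))
    moreover have "ev3 (mvar i) = u i"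
      by (simp add: ev3_def mvar_def weighted_sum_single D2(9) monomial_value(4)[OF u, simplified])
    ultimately show "xvar i \<in> A4" "ev4 (xvar i) = u i" by (simp_all add: xvar_def ev4)
  qed
  have emb: "emb p \<in> A4" "ev4 (emb p) = \<theta> p" for p
  proof -
    let ?s = "Poly_Mapping.single (to_grp p) 1 :: 'p mult_grp \<Rightarrow>\<^sub>0 int"
    have "?s \<in> A1" "ev1 ?s = \<theta> p"
      by (auto simp: A1_def ev1_def lookup_single when_def weighted_sum_single to_grp_inverse)
    then have s: "Fract ?s 1 \<in> A2" "ev2 (Fract ?s 1) = \<theta> p"
      by (simp_all add: ev2)
    then have "Fract ?s 1 \<noteq> 0" using \<theta>(1)[of p] D2(8) by auto
    then have "Poly_Mapping.single 0 (Fract ?s 1) \<in> A3" 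
      "ev3 (Poly_Mapping.single 0 (Fract ?s 1)) = \<theta> p"
      using s by (auto simp: A3_def ev3_def lookup_single when_def D2(1) weighted_sum_single
          monomial_value(2)[OF u])
    then show "emb p \<in> A4" "ev4 (emb p) = \<theta> p" by (simp_all add: emb_def ev4)
  qed
  \<comment> \<open>The semiring \<open>A4\<close> contains \<open>0\<close> and the generated semifield avoids it, by positivity.\<close>
  have pos: "a \<in> A4 \<and> ev4 a > 0" if "a \<in> gen_semifield (range xvar \<union> range emb)" for a
    using that
  proof induction
    case (gen a)
    then show ?case using xvar emb u \<theta>(1) by auto
  next
    case (divide a b)
    then have "b \<noteq> 0" using D4(8) by auto
    then have "ev4 (a / b) * ev4 b = ev4 a"
      using D4(6)[OF div4 , of a b b] divide by simp
    then have "ev4 (a / b) > 0" using divide by (metis zero_less_mult_pos2)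
    then show ?case using divide div4 by simp
  qed (simp_all add: D4)
  have "semifield_hom (gen_semifield (range xvar \<union> range emb)) {0<..} ev4"
    unfolding semifield_hom_def using pos D4(5,6) by simp
  then show ?thesis using xvar(2) emb(2) by (intro exI[of _ ev4]) simp
qed

lemma qplus_hom_exists:
  fixes t :: "nat \<Rightarrow> real"
  assumes "\<And>i. t i > 0"
  shows "\<exists>ev. semifield_hom UNIV {0<..} ev \<and> (\<forall>i. ev (yvar i) = t i)"
proof -
  have int: "positive_eval {0::int..} real_of_int"
    by (auto simp: positive_eval_def)
  define A where "A = {p :: int mpoly. \<forall>m. Poly_Mapping.lookup p m \<in> {0..}}"
  define ev where "ev = weighted_sum (monomial_value t) real_of_int"
  have 1: "positive_eval A ev"
    unfolding A_def ev_def
    by (rule poly_positive_eval[OF int]) (simp_all add: monomial_value[OF assms])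
  obtain B ev' where 2: "positive_eval B ev'" and div: "\<And>a b. a \<in> B \<Longrightarrow> b \<in> B \<Longrightarrow> a / b \<in> B"
    and ev': "\<And>p. p \<in> A \<Longrightarrow> Fract p 1 \<in> B \<and> ev' (Fract p 1) = ev p"
    by (rule fract_positive_eval[OF 1]) (rule that)
  note D2 = positive_evalD[OF 2]
  have in_B: "rat_fun f \<in> B" "rat_fun f \<noteq> 0" for f
  proof -
    obtain p q where f: "rat_fun f = Fract p q" and pq: "nonneg_poly p" "nonneg_poly q"
      using rat_fun[of f] by blast
    have "Fract p 1 / Fract q 1 \<in> B"
      using pq by (intro div) (simp_all add: ev' A_def nonneg_poly_def)
    then show "rat_fun f \<in> B" by (simp add: f)
    show "rat_fun f \<noteq> 0"
      using pq by (simp add: f Zero_fract_def eq_fract nonneg_poly_nonzero)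
  qed
  have "semifield_hom UNIV {0<..} (\<lambda>f. ev' (rat_fun f))"
    using in_B by (simp add: semifield_hom_def plus_qplus.rep_eq times_qplus.rep_eq D2(5-7))
  moreover have "ev' (rat_fun (yvar i)) = t i" for i
  proof -
    have "mvar i \<in> A" by (simp add: A_def mvar_def lookup_single when_def)
    moreover have "ev (mvar i) = t i"
      by (simp add: ev_def mvar_def weighted_sum_single monomial_value(4)[OF assms, simplified])
    ultimately show ?thesis by (simp add: yvar.rep_eq ev')
  qed
  ultimately show ?thesis by (intro exI[of _ "\<lambda>f. ev' (rat_fun f)"]) simp
qed

section \<open>Logarithms of evaluated seeds\<close>

text \<open>
  The structure is relative to a carrier, as cluster variables lie in a field and the positive elements
  among them form no type.
\<close>

definition log_hom :: "'a::{comm_monoid_mult,inverse} set \<Rightarrow> ('a \<Rightarrow> real) \<Rightarrow> bool" where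
  "log_hom A \<theta> \<longleftrightarrow> 1 \<in> A \<and> (\<forall>a\<in>A. inverse a \<in> A \<and> inverse a * a = 1) \<and>
     (\<forall>a\<in>A. \<forall>b\<in>A. a * b \<in> A \<and> \<theta> (a * b) = \<theta> a + \<theta> b)"

lemma log_homD:
  assumes "log_hom A \<theta>"
  shows "1 \<in> A" "\<theta> 1 = 0"
    and "a \<in> A \<Longrightarrow> inverse a \<in> A" "a \<in> A \<Longrightarrow> \<theta> (inverse a) = - \<theta> a"
    and "a \<in> A \<Longrightarrow> b \<in> A \<Longrightarrow> a * b \<in> A" "a \<in> A \<Longrightarrow> b \<in> A \<Longrightarrow> \<theta> (a * b) = \<theta> a + \<theta> b"
proof -
  show D: "1 \<in> A" "a \<in> A \<Longrightarrow> inverse a \<in> A" "a \<in> A \<Longrightarrow> b \<in> A \<Longrightarrow> a * b \<in> A"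
    "a \<in> A \<Longrightarrow> b \<in> A \<Longrightarrow> \<theta> (a * b) = \<theta> a + \<theta> b" for a b
    using assms unfolding log_hom_def by blast+
  show one: "\<theta> 1 = 0" using D(4)[OF D(1) D(1)] by simp
  show "\<theta> (inverse a) = - \<theta> a" if "a \<in> A"
  proof -
    have "\<theta> (inverse a * a) = \<theta> (inverse a) + \<theta> a" using that D by blast
    moreover have "inverse a * a = 1" using that assms unfolding log_hom_def by blast
    ultimately show ?thesis using one by simp
  qed
qed

lemma log_hom_power:
  assumes "log_hom A \<theta>" "a \<in> A"
  shows "a ^ m \<in> A \<and> \<theta> (a ^ m) = real m * \<theta> a"
  using assms(2) by (induction m) (auto simp: log_homD[OF assms(1)] algebra_simps)

lemma log_hom_powi:
  assumes "log_hom A \<theta>" "a \<in> A"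
  shows "a powi m \<in> A" "\<theta> (a powi m) = real_of_int m * \<theta> a"
  using log_hom_power[OF assms] log_hom_power[OF assms(1) log_homD(3)[OF assms]]
  by (simp_all add: power_int_def log_homD(4)[OF assms])

lemma log_hom_prod:
  assumes "log_hom A \<theta>" "\<And>i. i \<in> I \<Longrightarrow> g i \<in> A"
  shows "prod g I \<in> A \<and> \<theta> (prod g I) = (\<Sum>i\<in>I. \<theta> (g i))"
  using assms(2) by (induction I rule: infinite_finite_induct) (auto simp: log_homD[OF assms(1)])

definition positive_hom :: "'a::{plus,comm_monoid_mult,inverse} set \<Rightarrow> ('a \<Rightarrow> real) \<Rightarrow> bool" where
  "positive_hom A ev \<longleftrightarrow> 1 \<in> A \<and> (\<forall>a\<in>A. inverse a \<in> A \<and> inverse a * a = 1) \<and>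
     (\<forall>a\<in>A. \<forall>b\<in>A. a + b \<in> A \<and> a * b \<in> A) \<and> semifield_hom A {0<..} ev"

lemma positive_hom_log_hom: "positive_hom A ev \<Longrightarrow> log_hom A (\<lambda>a. ln (ev a))"
  by (auto simp: positive_hom_def log_hom_def semifield_hom_def ln_mult_pos)

definition softplus :: "real \<Rightarrow> real" where
  "softplus x = ln (1 + exp x)"

lemma positive_hom_one_plus:
  assumes ev: "positive_hom A ev" and a: "a \<in> A"
  shows "1 + a \<in> A" "ln (ev (1 + a)) = softplus (ln (ev a))"
proof -
  have one: "1 \<in> A" using log_homD(1)[OF positive_hom_log_hom[OF ev]] .
  have "ev 1 > 0" "ln (ev 1) = 0"
    using log_homD(2)[OF positive_hom_log_hom[OF ev]] ev one
    by (auto simp: positive_hom_def semifield_hom_def)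
  then have "ev 1 = 1" by simp
  then show "1 + a \<in> A" "ln (ev (1 + a)) = softplus (ln (ev a))"
    using ev a one by (auto simp: positive_hom_def semifield_hom_def softplus_def)
qed

lemma gen_semifield_mono: "G \<subseteq> H \<Longrightarrow> gen_semifield G \<subseteq> gen_semifield H"
proof
  fix a assume "G \<subseteq> H" "a \<in> gen_semifield G"
  from this(2,1) show "a \<in> gen_semifield H"
    by induction (auto intro: gen_semifield.intros)
qed

lemma semifield_hom_mono: "semifield_hom A C f \<Longrightarrow> B \<subseteq> A \<Longrightarrow> semifield_hom B C f"
  unfolding semifield_hom_def by blast

text \<open>
  Positivity of the values keeps \<open>0\<close> out: \<open>0 + 0 = 0\<close> would force the value of \<open>0\<close> to be \<open>0\<close>.
\<close>

lemma positive_hom_gen_semifield: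
  fixes G :: "'a::field set"
  assumes ev: "semifield_hom (gen_semifield G) {0::real<..} ev" and G: "G \<noteq> {}"
  shows "positive_hom (gen_semifield G) ev"
proof -
  have "0 \<notin> gen_semifield G"
  proof
    assume 0: "0 \<in> gen_semifield G"
    then have "ev (0 + 0) = ev 0 + ev 0" "ev 0 > 0"
      using ev unfolding semifield_hom_def by blast+
    then show False by simp
  qed
  then have nz: "a \<noteq> 0" if "a \<in> gen_semifield G" for a using that by blast
  obtain g where "g \<in> G" using G by blast
  then have "g \<in> gen_semifield G" by (rule gen_semifield.gen)
  then have "g / g \<in> gen_semifield G" "g \<noteq> 0"
    using nz by (blast intro: gen_semifield.divide)+
  then have one: "1 \<in> gen_semifield G" by (metis divide_self)
  have "inverse a \<in> gen_semifield G" if "a \<in> gen_semifield G" for a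
    using gen_semifield.divide[OF one that] by (simp add: inverse_eq_divide)
  then show ?thesis
    using one nz ev by (auto simp: positive_hom_def intro: gen_semifield.intros)
qed

lemma qplus_vars_closed:
  assumes "f \<in> qplus_vars n" "g \<in> qplus_vars n"
  shows "f + g \<in> qplus_vars n" "f * g \<in> qplus_vars n" "inverse f \<in> qplus_vars n"
proof -
  let ?v = "\<lambda>p::int mpoly. \<forall>m\<in>Poly_Mapping.keys p. Poly_Mapping.keys m \<subseteq> {..<n}"
  have mem: "h \<in> qplus_vars n \<longleftrightarrow>
      (\<exists>p q. nonneg_poly p \<and> nonneg_poly q \<and> rat_fun h = Fract p q \<and> ?v p \<and> ?v q)" for h
    unfolding qplus_vars_def by blast
  obtain p q where f: "nonneg_poly p" "nonneg_poly q" "rat_fun f = Fract p q" "?v p" "?v q"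
    using assms(1) unfolding mem by blast
  obtain r s where g: "nonneg_poly r" "nonneg_poly s" "rat_fun g = Fract r s" "?v r" "?v s"
    using assms(2) unfolding mem by blast
  have mult: "?v (a * b)" if "?v a" "?v b" for a b
  proof
    fix m assume "m \<in> Poly_Mapping.keys (a * b)"
    then obtain c d where "m = c + d" "c \<in> Poly_Mapping.keys a" "d \<in> Poly_Mapping.keys b"
      using keys_mult[of a b] by blast
    then show "Poly_Mapping.keys m \<subseteq> {..<n}"
      using that Poly_Mapping.keys_add[of c d] by fastforce
  qed
  have add: "?v (a + b)" if "?v a" "?v b" for a b
    using that Poly_Mapping.keys_add[of a b] by blast
  have "rat_fun (f + g) = Fract (p * s + r * q) (q * s)" "rat_fun (f * g) = Fract (p * r) (q * s)"
    "rat_fun (inverse f) = Fract q p"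
    using f g
    by (simp_all add: plus_qplus.rep_eq times_qplus.rep_eq inverse_qplus.rep_eq nonneg_poly_nonzero)
  note eqs = this
  have memI: "h \<in> qplus_vars n"
    if "rat_fun h = Fract a b" "nonneg_poly a" "nonneg_poly b" "?v a" "?v b" for h a b
    unfolding mem using that by blast
  show "f + g \<in> qplus_vars n"
    by (rule memI[OF eqs(1)]; intro nonneg_poly_add nonneg_poly_mult add mult f g)
  show "f * g \<in> qplus_vars n"
    by (rule memI[OF eqs(2)]; intro nonneg_poly_mult mult f g)
  show "inverse f \<in> qplus_vars n"
    by (rule memI[OF eqs(3)]; rule f)
qed

lemma yvar_in_qplus_vars: "i < n \<Longrightarrow> yvar i \<in> qplus_vars n"
  unfolding qplus_vars_def
  by (rule CollectI, rule exI[of _ "mvar i"], rule exI[of _ 1])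
    (simp add: yvar.rep_eq keys_one, simp add: mvar_def)

lemma one_in_qplus_vars: "1 \<in> qplus_vars n"
  unfolding qplus_vars_def
  by (intro CollectI exI[of _ 1]) (auto simp: one_qplus.rep_eq One_fract_def keys_one)

lemma positive_hom_qplus_vars:
  "semifield_hom (qplus_vars n) {0<..} ev \<Longrightarrow> positive_hom (qplus_vars n) ev"
  by (simp add: positive_hom_def one_in_qplus_vars qplus_vars_closed semifield_left_inverse)

lemma positive_hom_qplus:
  "semifield_hom UNIV {0<..} (ev :: qplus \<Rightarrow> real) \<Longrightarrow> positive_hom UNIV ev"
  by (simp add: positive_hom_def semifield_left_inverse)

lemma emb_one: "emb 1 = 1"
  by (simp add: emb_def zero_mult_grp_def[symmetric] One_fract_def[symmetric])

lemma emb_mult: "emb (p * q) = emb p * emb q"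
proof -
  have "to_grp (p * q) = to_grp p + to_grp q"
    by (metis of_grp_inverse plus_mult_grp.rep_eq to_grp_inverse UNIV_I)
  then show ?thesis by (simp add: emb_def mult_single)
qed

lemma exch_mutate: "exch (mutate n k S) = exch_step (exch S) k"
  by (simp add: mutate_def mutate_sign_def exch_step_def Let_def fun_eq_iff)

text \<open>
  Multiplicativity suffices, with the value of \<open>1 \<oplus> y\<^sub>k\<close> as a separate datum.  So the lemma applies both
  to evaluations of \<open>\<rat>\<^sub>+(y)\<close> and to evaluations of coefficients inside the ambient field.
\<close>

lemma log_coef_mutate:
  assumes \<theta>: "log_hom A \<theta>" and A: "coef S i \<in> A" "coef S k \<in> A" "1 + coef S k \<in> A"
  shows "coef (mutate n k S) i \<in> A"
    "\<theta> (coef (mutate n k S) i) =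
       coef_step (exch S) k (\<theta> (1 + coef S k)) (\<lambda>i. \<theta> (coef S i)) i"
proof -
  have 1: "coef S k powi 1 = coef S k" by (simp add: power_int_def)
  show "coef (mutate n k S) i \<in> A"
    "\<theta> (coef (mutate n k S) i) =
       coef_step (exch S) k (\<theta> (1 + coef S k)) (\<lambda>i. \<theta> (coef S i)) i"
    using A
    by (auto simp: mutate_def mutate_sign_def Let_def coef_step_def 1
        log_homD[OF \<theta>] log_hom_powi[OF \<theta>])
qed

lemma hat_log_cong: "(\<And>j. j < n \<Longrightarrow> f j = g j) \<Longrightarrow> hat_log n b z f i = hat_log n b z g i"
  by (simp add: hat_log_def)

lemma log_yhat:
  assumes \<theta>: "log_hom A \<theta>" and A: "emb (coef S i) \<in> A" "\<And>j. j < n \<Longrightarrow> clus S j \<in> A"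
  shows "yhat n S i \<in> A"
    "\<theta> (yhat n S i) = hat_log n (exch S) (\<lambda>i. \<theta> (emb (coef S i))) (\<lambda>j. \<theta> (clus S j)) i"
proof -
  have *: "(\<Prod>j<n. clus S j powi exch S j i) \<in> A \<and> \<theta> (\<Prod>j<n. clus S j powi exch S j i) =
    (\<Sum>j<n. \<theta> (clus S j powi exch S j i))"
    by (rule log_hom_prod[OF \<theta>]) (simp add: log_hom_powi[OF \<theta>] A)
  then show "yhat n S i \<in> A"
    "\<theta> (yhat n S i) = hat_log n (exch S) (\<lambda>i. \<theta> (emb (coef S i))) (\<lambda>j. \<theta> (clus S j)) i"
    using A by (simp_all add: yhat_def hat_log_def log_homD[OF \<theta>] log_hom_powi[OF \<theta>])
qed

lemma log_clus_mutate:
  assumes ev: "positive_hom A ev" and emb: "\<And>p. emb p \<in> A"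
    and A: "\<And>j. j < n \<Longrightarrow> clus S j \<in> A" and k: "k < n" and i: "i < n"
  shows "clus (mutate n k S) i \<in> A"
    "ln (ev (clus (mutate n k S) i)) =
       clus_step n (exch S) k (softplus (ln (ev (yhat n S k))) - ln (ev (emb (1 + coef S k))))
         (\<lambda>j. ln (ev (clus S j))) i"
proof -
  note \<theta> = positive_hom_log_hom[OF ev]
  note D = log_homD[OF \<theta>] log_hom_powi[OF \<theta>] positive_hom_one_plus[OF ev]
  let ?P = "\<Prod>j<n. clus S j powi pos_part (- exch S j k)"
  have P: "?P \<in> A \<and> ln (ev ?P) = (\<Sum>j<n. ln (ev (clus S j powi pos_part (- exch S j k))))"
    by (rule log_hom_prod[OF \<theta>]) (simp add: D A)
  have yh: "yhat n S k \<in> A" by (rule log_yhat(1)[OF \<theta> emb A])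
  have 1: "coef S k powi 1 = coef S k" by (simp add: power_int_def)
  have k': "clus (mutate n k S) k =
      inverse (clus S k) * ?P * ((1 + yhat n S k) * inverse (emb (1 + coef S k)))"
    by (simp add: mutate_def mutate_sign_def Let_def 1 divide_inverse)
  show "clus (mutate n k S) i \<in> A"
    "ln (ev (clus (mutate n k S) i)) =
       clus_step n (exch S) k (softplus (ln (ev (yhat n S k))) - ln (ev (emb (1 + coef S k))))
         (\<lambda>j. ln (ev (clus S j))) i"
  proof (atomize (full), cases "i = k")
    case True
    show "clus (mutate n k S) i \<in> A \<and> ln (ev (clus (mutate n k S) i)) =
       clus_step n (exch S) k (softplus (ln (ev (yhat n S k))) - ln (ev (emb (1 + coef S k))))
         (\<lambda>j. ln (ev (clus S j))) i"
      unfolding True k' using P yh emb A k by (simp add: clus_step_def D)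
  next
    case False
    then show "clus (mutate n k S) i \<in> A \<and> ln (ev (clus (mutate n k S) i)) =
       clus_step n (exch S) k (softplus (ln (ev (yhat n S k))) - ln (ev (emb (1 + coef S k))))
         (\<lambda>j. ln (ev (clus S j))) i"
      using A i by (simp add: mutate_def mutate_sign_def Let_def clus_step_def)
  qed
qed

section \<open>Logarithms along a mutation sequence\<close>

primrec exch_seq :: "(nat \<Rightarrow> nat \<Rightarrow> int) \<Rightarrow> (nat \<Rightarrow> nat) \<Rightarrow> nat \<Rightarrow> nat \<Rightarrow> nat \<Rightarrow> int" where
  "exch_seq B k 0 = B"
| "exch_seq B k (Suc s) = exch_step (exch_seq B k s) (k s)"

lemma exch_seed_seq: "exch (seed_seq n k S s) = exch_seq (exch S) k s"
  by (induction s) (simp_all add: exch_mutate)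

lemma skew_symmetrizer_exch_seq:
  assumes "skew_symmetrizer n d B" "\<And>s. s < T \<Longrightarrow> k s < n" "s \<le> T"
  shows "skew_symmetrizer n d (exch_seq B k s)"
  using assms(3) by (induction s) (use assms in \<open>auto intro: skew_symmetrizer_step\<close>)

primrec log_coef_seq ::
    "(nat \<Rightarrow> nat \<Rightarrow> int) \<Rightarrow> (nat \<Rightarrow> nat) \<Rightarrow> (nat \<Rightarrow> real) \<Rightarrow> nat \<Rightarrow> nat \<Rightarrow> real" where
  "log_coef_seq B k \<tau> 0 = \<tau>"
| "log_coef_seq B k \<tau> (Suc s) =
     coef_step (exch_seq B k s) (k s) (softplus (log_coef_seq B k \<tau> s (k s))) (log_coef_seq B k \<tau> s)"

lemma log_coef_seed_seq:
  assumes ev: "positive_hom A ev" and k: "\<And>s. s < T \<Longrightarrow> k s < n"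
    and A: "\<And>i. i < n \<Longrightarrow> coef S i \<in> A \<and> ln (ev (coef S i)) = \<tau> i"
    and s: "s \<le> T" and i: "i < n"
  shows "coef (seed_seq n k S s) i \<in> A"
    "ln (ev (coef (seed_seq n k S s) i)) = log_coef_seq (exch S) k \<tau> s i"
proof -
  have "\<forall>i<n. coef (seed_seq n k S s) i \<in> A \<and>
      ln (ev (coef (seed_seq n k S s) i)) = log_coef_seq (exch S) k \<tau> s i"
    using s
  proof (induction s)
    case 0
    then show ?case using A by simp
  next
    case (Suc s)
    let ?S = "seed_seq n k S s"
    have ks: "k s < n" using Suc.prems k by simp
    have IH: "coef ?S i \<in> A" "ln (ev (coef ?S i)) = log_coef_seq (exch S) k \<tau> s i" if "i < n" for i
      using Suc that by auto
    show ?case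
    proof (intro allI impI)
      fix i assume i: "i < n"
      note step = log_coef_mutate[OF positive_hom_log_hom[OF ev] IH(1)[OF i] IH(1)[OF ks]
          positive_hom_one_plus(1)[OF ev IH(1)[OF ks]], where n = n]
      show "coef (seed_seq n k S (Suc s)) i \<in> A \<and>
          ln (ev (coef (seed_seq n k S (Suc s)) i)) = log_coef_seq (exch S) k \<tau> (Suc s) i"
        using step i ks
        by (simp add: positive_hom_one_plus(2)[OF ev] IH coef_step_def exch_seed_seq)
    qed
  qed
  then show "coef (seed_seq n k S s) i \<in> A"
    "ln (ev (coef (seed_seq n k S s) i)) = log_coef_seq (exch S) k \<tau> s i" using i by auto
qed

lemma clus_seed_seq_in:
  assumes ev: "positive_hom A ev" and emb: "\<And>p. emb p \<in> A"
    and A: "\<And>j. j < n \<Longrightarrow> clus S j \<in> A"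
    and k: "\<And>s. s < T \<Longrightarrow> k s < n" and s: "s \<le> T" and i: "i < n"
  shows "clus (seed_seq n k S s) i \<in> A"
  using s i
proof (induction s arbitrary: i)
  case (Suc s)
  then show ?case
    using log_clus_mutate(1)[OF ev emb, of n "seed_seq n k S s" "k s" i] k[of s] by simp
qed (simp add: A)

text \<open>
  The same recursion as for the coefficients in \<open>log_coef_seed_seq\<close>: after evaluation, the hatted variables
  are the \<open>y\<close>-variables started at the initial hatted variables.
\<close>

lemma log_yhat_seed_seq:
  assumes ev: "positive_hom A ev" and emb: "\<And>p. emb p \<in> A"
    and A: "\<And>j. j < n \<Longrightarrow> clus S j \<in> A"
    and k: "\<And>s. s < T \<Longrightarrow> k s < n" and d: "skew_symmetrizer n d (exch S)"
    and s: "s \<le> T"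
  shows "(\<lambda>i. ln (ev (yhat n (seed_seq n k S s) i))) =
     log_coef_seq (exch S) k (\<lambda>i. ln (ev (yhat n S i))) s"
  using s
proof (induction s)
  case (Suc s)
  let ?S = "seed_seq n k S s"
  let ?S' = "mutate n (k s) ?S"
  let ?\<theta> = "\<lambda>a. ln (ev a)"
  note \<theta> = positive_hom_log_hom[OF ev]
  have ks: "k s < n" using Suc.prems k by simp
  have in_A: "clus (seed_seq n k S r) j \<in> A" if "j < n" "r \<le> T" for r j
    using clus_seed_seq_in[where k = k and T = T, OF ev emb A k that(2,1)] .
  have clus: "clus ?S j \<in> A" "clus ?S' j \<in> A" if "j < n" for j
    using in_A[of j s] in_A[of j "Suc s"] Suc.prems that by simp_all
  have diag: "exch ?S (k s) (k s) = 0"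
    unfolding exch_seed_seq
    by (rule skew_symmetrizer_diag[OF skew_symmetrizer_exch_seq[where k = k and T = T and s = s, OF d k
            Suc_leD[OF Suc.prems]] ks])
  have emb_hom: "log_hom UNIV (\<lambda>p. ?\<theta> (emb p))"
    using log_homD(6)[OF \<theta> emb emb]
    by (simp add: log_hom_def emb_mult semifield_left_inverse)
  have coef': "(\<lambda>i. ?\<theta> (emb (coef ?S' i))) =
      coef_step (exch ?S) (k s) (?\<theta> (emb (1 + coef ?S (k s)))) (\<lambda>i. ?\<theta> (emb (coef ?S i)))"
    using log_coef_mutate(2)[OF emb_hom, where S = ?S and k = "k s" and n = n]
    by (intro ext) (simp only: UNIV_I simp_thms)
  have clus': "?\<theta> (clus ?S' j) = clus_step n (exch ?S) (k s)
      (softplus (?\<theta> (yhat n ?S (k s))) - ?\<theta> (emb (1 + coef ?S (k s)))) (\<lambda>j. ?\<theta> (clus ?S j)) j"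
    if "j < n" for j
    by (rule log_clus_mutate(2)[OF ev emb clus(1) ks that])
  show ?case
  proof
    fix i
    have "?\<theta> (yhat n ?S' i) = hat_log n (exch ?S') (\<lambda>i. ?\<theta> (emb (coef ?S' i))) (\<lambda>j. ?\<theta> (clus ?S' j)) i"
      by (rule log_yhat(2)[OF \<theta> emb clus(2)])
    also have "\<dots> = hat_log n (exch_step (exch ?S) (k s))
        (coef_step (exch ?S) (k s) (?\<theta> (emb (1 + coef ?S (k s)))) (\<lambda>i. ?\<theta> (emb (coef ?S i))))
        (clus_step n (exch ?S) (k s) (softplus (?\<theta> (yhat n ?S (k s))) - ?\<theta> (emb (1 + coef ?S (k s))))
          (\<lambda>j. ?\<theta> (clus ?S j))) i"
      unfolding coef' exch_mutate by (rule hat_log_cong) (rule clus')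
    also have "\<dots> = coef_step (exch ?S) (k s) (softplus (?\<theta> (yhat n ?S (k s))))
        (hat_log n (exch ?S) (\<lambda>i. ?\<theta> (emb (coef ?S i))) (\<lambda>j. ?\<theta> (clus ?S j))) i"
      by (rule hat_log_step[where b = "exch ?S", OF ks diag])
    also have "hat_log n (exch ?S) (\<lambda>i. ?\<theta> (emb (coef ?S i))) (\<lambda>j. ?\<theta> (clus ?S j)) =
        (\<lambda>i. ?\<theta> (yhat n ?S i))"
      by (rule ext) (rule log_yhat(2)[OF \<theta> emb clus(1), symmetric])
    finally show "?\<theta> (yhat n (seed_seq n k S (Suc s)) i) =
        log_coef_seq (exch S) k (\<lambda>i. ?\<theta> (yhat n S i)) (Suc s) i"
      by (simp only: seed_seq.simps log_coef_seq.simps exch_seed_seq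
          Suc.IH[OF Suc_leD[OF Suc.prems], symmetric])
  qed
qed simp

section \<open>Constancy of dilogarithm sums along rays\<close>

text \<open>
  The function \<open>sp\<close> is \<open>softplus\<close> for real numbers and \<open>dual_softplus\<close> for pairs.
\<close>

primrec log_clus_seq ::
    "('v::real_vector \<Rightarrow> 'v) \<Rightarrow> nat \<Rightarrow> (nat \<Rightarrow> nat \<Rightarrow> int) \<Rightarrow> (nat \<Rightarrow> nat) \<Rightarrow>
     (nat \<Rightarrow> nat \<Rightarrow> 'v) \<Rightarrow> (nat \<Rightarrow> 'v) \<Rightarrow> nat \<Rightarrow> nat \<Rightarrow> 'v" where
  "log_clus_seq sp n B k z m 0 = (\<lambda>_. 0)"
| "log_clus_seq sp n B k z m (Suc s) = clus_step n (exch_seq B k s) (k s)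
     (sp (hat_log n (exch_seq B k s) (z s) (log_clus_seq sp n B k z m s) (k s)) - m s)
     (log_clus_seq sp n B k z m s)"

text \<open>
  A pair consists of the value and the derivative of a function of \<open>r\<close>, so it is a dual number, and this is
  the extension of \<open>softplus\<close> to dual numbers.
\<close>

definition dual_softplus :: "real \<times> real \<Rightarrow> real \<times> real" where
  "dual_softplus v = (softplus (fst v), snd v * (exp (fst v) / (1 + exp (fst v))))"

definition has_jet :: "(real \<Rightarrow> real) \<Rightarrow> real \<Rightarrow> real \<times> real \<Rightarrow> bool" where
  "has_jet g r v \<longleftrightarrow> fst v = g r \<and> (g has_real_derivative snd v) (at r)"

lemma has_jet_intros:
  "has_jet (\<lambda>_. 0) r 0"
  "has_jet (\<lambda>r. r * c) r (r * c, c)"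
  "has_jet f r u \<Longrightarrow> has_jet (\<lambda>r. - f r) r (- u)"
  "has_jet f r u \<Longrightarrow> has_jet g r v \<Longrightarrow> has_jet (\<lambda>r. f r + g r) r (u + v)"
  "has_jet f r u \<Longrightarrow> has_jet g r v \<Longrightarrow> has_jet (\<lambda>r. f r - g r) r (u - v)"
  "has_jet f r u \<Longrightarrow> has_jet (\<lambda>r. c *\<^sub>R f r) r (c *\<^sub>R u)"
  by (auto simp: has_jet_def intro!: derivative_eq_intros)

lemma has_jet_sum:
  "(\<And>i. i \<in> I \<Longrightarrow> has_jet (\<lambda>r. f r i) r (u i)) \<Longrightarrow>
     has_jet (\<lambda>r. \<Sum>i\<in>I. f r i) r (\<Sum>i\<in>I. u i)"
  by (induction I rule: infinite_finite_induct) (auto intro: has_jet_intros)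

lemma has_jet_softplus:
  assumes "has_jet f r u"
  shows "has_jet (\<lambda>r. softplus (f r)) r (dual_softplus u)"
proof -
  have "1 + exp (f r) > 0" by (simp add: add_pos_pos)
  then show ?thesis
    using assms by (auto simp: has_jet_def dual_softplus_def softplus_def intro!: derivative_eq_intros)
qed

lemma has_jet_hat_log:
  assumes "\<And>i. has_jet (\<lambda>r. z r i) r (u i)" "\<And>i. has_jet (\<lambda>r. f r i) r (v i)"
  shows "has_jet (\<lambda>r. hat_log n b (z r) (f r) i) r (hat_log n b u v i)"
  unfolding hat_log_def by (intro has_jet_intros has_jet_sum assms)

lemma has_jet_clus_step:
  assumes "\<And>i. has_jet (\<lambda>r. f r i) r (u i)" "has_jet c r v"
  shows "has_jet (\<lambda>r. clus_step n b k (c r) (f r) i) r (clus_step n b k v u i)"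
proof (cases "i = k")
  case True
  show ?thesis
    unfolding clus_step_def if_P[OF True] by (intro has_jet_intros has_jet_sum assms)
next
  case False
  show ?thesis
    unfolding clus_step_def if_not_P[OF False] by (rule assms)
qed

lemma has_jet_log_clus_seq:
  "has_jet (\<lambda>r. log_clus_seq softplus n B k (\<lambda>s i. r * z s i) (\<lambda>s. r * m s) s i) r
     (log_clus_seq dual_softplus n B k (\<lambda>s i. (r * z s i, z s i)) (\<lambda>s. (r * m s, m s)) s i)"
proof (induction s arbitrary: i)
  case 0
  then show ?case by (simp add: has_jet_intros)
next
  case (Suc s)
  show ?case
    unfolding log_clus_seq.simps
    by (intro has_jet_clus_step has_jet_intros has_jet_softplus has_jet_hat_log Suc.IH)
qed

definition wedge :: "real \<times> real \<Rightarrow> real \<times> real \<Rightarrow> real" where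
  "wedge u v = fst u * snd v - snd u * fst v"

lemma bilinear_wedge: "bilinear wedge"
  unfolding bilinear_def by (auto intro!: linearI simp: wedge_def algebra_simps)

lemma rogers_L_exp_has_derivative:
  "((\<lambda>x. rogers_L (exp x)) has_real_derivative
     (softplus x - exp x / (1 + exp x) * x) / 2) (at x)"
proof -
  have "((\<lambda>x. rogers_L (exp x)) has_real_derivative
      (ln (1 + exp x) / exp x - ln (exp x) / (1 + exp x)) / 2 * exp x) (at x)"
    by (rule DERIV_chain'[OF DERIV_exp rogers_L_has_derivative]) simp
  moreover have "(ln (1 + exp x) / exp x - ln (exp x) / (1 + exp x)) / 2 * exp x =
      (softplus x - exp x / (1 + exp x) * x) / 2"
    by (simp add: softplus_def left_diff_distrib)
  ultimately show ?thesis by simp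
qed

text \<open>
  The sign does not influence the derivative: replacing \<open>w\<close> by \<open>- w\<close> changes \<open>softplus w\<close> by \<open>- w\<close>,
  and a function wedged with itself vanishes.
\<close>

lemma signed_rogers_L_jet:
  assumes w: "has_jet w r v" and \<epsilon>: "\<epsilon> = 1 \<or> \<epsilon> = (- 1 :: int)"
  shows "((\<lambda>r. real_of_int \<epsilon> * rogers_L (exp (w r) powi \<epsilon>)) has_real_derivative
     wedge (dual_softplus v) v / 2) (at r)"
proof -
  have w': "(w has_real_derivative snd v) (at r)" and fst: "fst v = w r"
    using w by (simp_all add: has_jet_def)
  have pos: "1 + exp (w r) > 0" by (simp add: add_pos_pos)
  have wedge: "wedge (dual_softplus v) v / 2 = (softplus (w r) - exp (w r) / (1 + exp (w r)) * w r) / 2 * snd v"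
    by (simp add: wedge_def dual_softplus_def fst algebra_simps)
  show ?thesis
  proof (cases "\<epsilon> = 1")
    case True
    show ?thesis
      unfolding wedge using DERIV_chain'[OF w' rogers_L_exp_has_derivative] True by simp
  next
    case False
    then have eps: "\<epsilon> = - 1" using \<epsilon> by simp
    have "1 + exp (- w r) = (1 + exp (w r)) / exp (w r)" by (simp add: exp_minus field_simps)
    then have sp: "softplus (- w r) = softplus (w r) - w r"
      using pos by (simp add: softplus_def ln_div)
    have frac: "exp (- w r) / (1 + exp (- w r)) = 1 - exp (w r) / (1 + exp (w r))"
      using pos by (simp add: exp_minus field_simps)
    have ring_eq: "- (((S - W) - (1 - F) * (- W)) / 2 * (- V)) = (S - F * W) / 2 * V" for S W F V :: real
      by (simp add: field_simps)
    have "((\<lambda>r. - rogers_L (exp (- w r))) has_real_derivative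
        - ((softplus (- w r) - exp (- w r) / (1 + exp (- w r)) * (- w r)) / 2 * (- snd v))) (at r)"
      by (rule DERIV_minus[OF DERIV_chain'[OF DERIV_minus[OF w'] rogers_L_exp_has_derivative]])
    then have "((\<lambda>r. - rogers_L (exp (- w r))) has_real_derivative
        (softplus (w r) - exp (w r) / (1 + exp (w r)) * w r) / 2 * snd v) (at r)"
      unfolding sp frac by (rule DERIV_cong) (rule ring_eq)
    then show ?thesis
      unfolding wedge by (simp add: eps exp_minus)
  qed
qed

definition dilog_sum ::
    "nat \<Rightarrow> (nat \<Rightarrow> nat \<Rightarrow> int) \<Rightarrow> (nat \<Rightarrow> nat) \<Rightarrow> (nat \<Rightarrow> int) \<Rightarrow> (nat \<Rightarrow> int) \<Rightarrow> (nat \<Rightarrow> real) \<Rightarrow> real" where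
  "dilog_sum T B k d \<epsilon> \<tau> = (\<Sum>s<T. real_of_int (\<epsilon> s) / real_of_int (d (k s)) *
     rogers_L (exp (log_coef_seq B k \<tau> s (k s)) powi \<epsilon> s))"

text \<open>
  The derivative in \<open>r\<close> of the dilogarithm sum at \<open>r \<tau>\<close> telescopes to a multiple of \<open>V T - V 0\<close>, where
  \<open>V s\<close> is the \<open>pairing\<close> of the jets of cluster variables \<open>c'\<close>, of coefficients \<open>z'\<close> and of hatted
  variables \<open>w'\<close>.  The pairing vanishes with its first argument, so it is zero at \<open>s = 0\<close> by the initial values and
  at \<open>s = T\<close> by \<open>periodic\<close>.
\<close>

lemma dilog_sum_const_on_ray:
  fixes \<tau> :: "nat \<Rightarrow> real" and B :: "nat \<Rightarrow> nat \<Rightarrow> int" and k :: "nat \<Rightarrow> nat"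
  defines "z \<equiv> log_coef_seq B k \<tau>"
  defines "m \<equiv> \<lambda>s. softplus (z s (k s))"
  assumes d: "skew_symmetrizer n d B" and k: "\<And>s. s < T \<Longrightarrow> k s < n"
    and \<epsilon>: "\<And>s. \<epsilon> s = 1 \<or> \<epsilon> s = - 1"
    and periodic: "\<And>r i. i < n \<Longrightarrow>
      log_clus_seq softplus n B k (\<lambda>s i. r * z s i) (\<lambda>s. r * m s) T i = 0"
  shows "dilog_sum T B k d \<epsilon> \<tau> = dilog_sum T B k d \<epsilon> (\<lambda>_. 0)"
proof -
  define c where "c r = log_clus_seq softplus n B k (\<lambda>s i. r * z s i) (\<lambda>s. r * m s)" for r
  define c' where "c' r = log_clus_seq dual_softplus n B k (\<lambda>s i. (r * z s i, z s i)) (\<lambda>s. (r * m s, m s))" for r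
  define z' where "z' r s = (\<lambda>i. (r * z s i, z s i))" for r s
  define w' where "w' r s = hat_log n (exch_seq B k s) (z' r s) (c' r s)" for r s
  have diag: "exch_seq B k s (k s) (k s) = 0" if "s < T" for s
    using skew_symmetrizer_diag[OF skew_symmetrizer_exch_seq[where k = k and T = T, OF d k less_imp_le[OF that]] k[OF that]] .
  have z_Suc: "z (Suc s) = coef_step (exch_seq B k s) (k s) (m s) (z s)" for s
    by (simp add: z_def m_def)
  have w: "log_coef_seq B k (\<lambda>i. r * \<tau> i) s = hat_log n (exch_seq B k s) (\<lambda>i. r * z s i) (c r s)"
    if "s \<le> T" for r s
    using that
  proof (induction s)
    case 0
    show ?case by (simp add: z_def c_def hat_log_def fun_eq_iff)
  next
    case (Suc s)
    have rz: "(\<lambda>i. r * z (Suc s) i) = coef_step (exch_seq B k s) (k s) (r * m s) (\<lambda>i. r * z s i)"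
      by (auto simp: z_Suc coef_step_def fun_eq_iff algebra_simps)
    have cS: "c r (Suc s) = clus_step n (exch_seq B k s) (k s)
       (softplus (hat_log n (exch_seq B k s) (\<lambda>i. r * z s i) (c r s) (k s)) - r * m s) (c r s)"
      by (simp add: c_def)
    show ?case
      unfolding rz cS exch_seq.simps log_coef_seq.simps Suc.IH[OF Suc_leD[OF Suc.prems]]
      by (rule ext, rule hat_log_step[where b = "exch_seq B k s", symmetric])
        (use Suc.prems in \<open>auto intro: k diag\<close>)
  qed
  have w_jet: "has_jet (\<lambda>r. log_coef_seq B k (\<lambda>i. r * \<tau> i) s i) r (w' r s i)" if "s \<le> T" for r s i
    unfolding w[OF that] w'_def z'_def c_def c'_def
    by (intro has_jet_hat_log has_jet_intros has_jet_log_clus_seq)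
  define V where "V r s = pairing wedge n d (c' r s) (z' r s) (w' r s)" for r s
  have V_Suc: "V r (Suc s) - V r s = - 2 * (wedge (dual_softplus (w' r s (k s))) (w' r s (k s)) / d (k s))"
    if s: "s < T" for r s
  proof -
    let ?b = "exch_seq B k s" and ?l = "dual_softplus (w' r s (k s))" and ?m = "(r * m s, m s)"
    have z'S: "z' r (Suc s) = coef_step ?b (k s) ?m (z' r s)"
      by (auto simp: z'_def z_Suc coef_step_def fun_eq_iff algebra_simps)
    have c'S: "c' r (Suc s) = clus_step n ?b (k s) (?l - ?m) (c' r s)"
      by (simp add: c'_def w'_def z'_def)
    have w'S: "w' r (Suc s) = coef_step ?b (k s) ?l (w' r s)"
      unfolding w'_def[of r "Suc s"] z'S c'S exch_seq.simps unfolding w'_def[of r s]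
      by (rule ext, rule hat_log_step[where b = ?b, OF k[OF s] diag[OF s]])
    have "V r (Suc s) = V r s + 2 * (wedge ?m (z' r s (k s)) - wedge ?l (w' r s (k s))) / d (k s)"
      unfolding V_def z'S c'S w'S
      by (rule pairing_step[OF bilinear_wedge _ skew_symmetrizer_exch_seq[where k = k and T = T, OF d k less_imp_le[OF s]] k[OF s] w'_def])
        (simp_all add: wedge_def)
    \<comment> \<open>Both functions are linear in \<open>r\<close>, hence proportional.\<close>
    moreover have "wedge ?m (z' r s (k s)) = 0" by (simp add: wedge_def z'_def)
    ultimately show ?thesis by simp
  qed
  have V_0: "V r 0 = 0" for r
    by (simp add: V_def pairing_def c'_def wedge_def)
  have V_T: "V r T = 0" for r
  proof -
    have "c' r T i = 0" if "i < n" for i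
    proof -
      have "has_jet (\<lambda>_. 0) r (c' r T i)"
        using has_jet_log_clus_seq[of n B k z m T i r] periodic[OF that] by (simp add: c'_def)
      then have "fst (c' r T i) = 0" "((\<lambda>_. 0) has_real_derivative snd (c' r T i)) (at r)"
        by (simp_all add: has_jet_def)
      then show ?thesis using DERIV_unique[OF _ DERIV_const] by (simp add: prod_eq_iff)
    qed
    then show ?thesis by (simp add: V_def pairing_def wedge_def)
  qed
  have "((\<lambda>r. dilog_sum T B k d \<epsilon> (\<lambda>i. r * \<tau> i)) has_real_derivative 0) (at r)" for r
  proof -
    have "((\<lambda>r. dilog_sum T B k d \<epsilon> (\<lambda>i. r * \<tau> i)) has_real_derivative
       (\<Sum>s<T. wedge (dual_softplus (w' r s (k s))) (w' r s (k s)) / 2 / d (k s))) (at r)"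
      unfolding dilog_sum_def times_divide_eq_left
      by (intro DERIV_sum DERIV_cdivide signed_rogers_L_jet w_jet \<epsilon>) simp
    also have "(\<Sum>s<T. wedge (dual_softplus (w' r s (k s))) (w' r s (k s)) / 2 / d (k s)) =
       (\<Sum>s<T. - (V r (Suc s) - V r s) / 4)"
      by (rule sum.cong) (simp_all add: V_Suc)
    also have "\<dots> = - (V r T - V r 0) / 4"
      by (simp add: sum_divide_distrib[symmetric] sum_negf sum_lessThan_telescope del: minus_diff_eq)
    finally show ?thesis by (simp add: V_0 V_T)
  qed
  then have "dilog_sum T B k d \<epsilon> (\<lambda>i. 1 * \<tau> i) = dilog_sum T B k d \<epsilon> (\<lambda>i. 0 * \<tau> i)"
    using DERIV_isconst_all[of "\<lambda>r. dilog_sum T B k d \<epsilon> (\<lambda>i. r * \<tau> i)" 1 0] by blast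
  then show ?thesis by simp
qed

lemma tropical_sign_seq_cases: "tropical_sign_seq n B k s = 1 \<or> tropical_sign_seq n B k s = - 1"
  by (simp add: tropical_sign_seq_def tropical_sign_def)

section \<open>Equivalence of the two families of identities\<close>

lemma dilog_sum_coef:
  assumes ev: "positive_hom A ev" and k: "\<And>s. s < T \<Longrightarrow> k s < n"
    and A: "\<And>i. i < n \<Longrightarrow> yvar i \<in> A \<and> ln (ev (yvar i)) = \<tau> i"
  shows "(\<Sum>s<T. real_of_int (\<epsilon> s) / real_of_int (d (k s)) *
      rogers_L (ev (coef (qseed n B k s) (k s)) powi \<epsilon> s)) = dilog_sum T B k d \<epsilon> \<tau>"
  unfolding dilog_sum_def
proof (rule sum.cong)
  fix s assume "s \<in> {..<T}"
  then have s: "s \<le> T" "k s < n" using k by auto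
  let ?y = "coef (qseed n B k s) (k s)"
  have "?y \<in> A" "ln (ev ?y) = log_coef_seq B k \<tau> s (k s)"
    using log_coef_seed_seq[where S = "initial_seed B yvar" and \<tau> = \<tau> and k = k and T = T, OF ev k _ s] A
    by (simp_all add: qseed_def initial_seed_def)
  moreover have "ev ?y > 0" using ev \<open>?y \<in> A\<close> by (auto simp: positive_hom_def semifield_hom_def)
  ultimately have "ev ?y = exp (log_coef_seq B k \<tau> s (k s))" by (metis exp_ln)
  then show "real_of_int (\<epsilon> s) / real_of_int (d (k s)) * rogers_L (ev ?y powi \<epsilon> s) =
    real_of_int (\<epsilon> s) / real_of_int (d (k s)) * rogers_L (exp (log_coef_seq B k \<tau> s (k s)) powi \<epsilon> s)"
    by simp
qed simp

lemma dilog_sum_yhat: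
  assumes ev: "positive_hom A ev" and A: "\<And>i. i < n \<Longrightarrow> xvar i \<in> A"
    and k: "\<And>s. s < T \<Longrightarrow> k s < n" and B: "skew_symmetrizer n d B"
  shows "(\<Sum>s<T. real_of_int (\<epsilon> s) / real_of_int (d (k s)) *
      rogers_L (ev (\<Prod>j<n. clus (tseed n B k s) j powi exch (tseed n B k s) j (k s)) powi \<epsilon> s)) =
    dilog_sum T B k d \<epsilon> (\<lambda>i. ln (ev (yhat n (initial_seed B (\<lambda>_. 1)) i)))"
  unfolding dilog_sum_def
proof (rule sum.cong)
  let ?I = "initial_seed B (\<lambda>_. 1) :: unit seed"
  have one: "emb p = 1" for p :: unit
    using emb_one[where 'a = unit] by (cases p) (simp add: one_unit_def)
  have emb: "emb p \<in> A" for p :: unit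
    using log_homD(1)[OF positive_hom_log_hom[OF ev]] by (simp only: one)
  have A0: "clus ?I j \<in> A" if "j < n" for j
    using A[OF that] by (simp add: initial_seed_def)
  fix s assume "s \<in> {..<T}"
  then have s: "s \<le> T" "k s < n" using k by auto
  let ?S = "tseed n B k s"
  have yhat: "yhat n ?S (k s) = (\<Prod>j<n. clus ?S j powi exch ?S j (k s))"
    by (simp add: yhat_def one)
  have "yhat n ?S (k s) \<in> A"
    unfolding tseed_def
    by (rule log_yhat(1)[OF positive_hom_log_hom[OF ev] emb
          clus_seed_seq_in[where k = k and T = T, OF ev emb A0 k s(1)]])
  then have pos: "ev (yhat n ?S (k s)) > 0"
    using ev by (auto simp: positive_hom_def semifield_hom_def)
  have d: "skew_symmetrizer n d (exch ?I)" using B by (simp add: initial_seed_def)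
  have "ln (ev (yhat n ?S (k s))) = log_coef_seq B k (\<lambda>i. ln (ev (yhat n ?I i))) s (k s)"
    using fun_cong[OF log_yhat_seed_seq[where k = k and T = T, OF ev emb A0 k d s(1)], of "k s"]
    unfolding tseed_def by (simp add: initial_seed_def)
  then have "ev (yhat n ?S (k s)) = exp (log_coef_seq B k (\<lambda>i. ln (ev (yhat n ?I i))) s (k s))"
    using pos by (metis exp_ln)
  then show "real_of_int (\<epsilon> s) / real_of_int (d (k s)) *
      rogers_L (ev (\<Prod>j<n. clus ?S j powi exch ?S j (k s)) powi \<epsilon> s) =
    real_of_int (\<epsilon> s) / real_of_int (d (k s)) *
      rogers_L (exp (log_coef_seq B k (\<lambda>i. ln (ev (yhat n ?I i))) s (k s)) powi \<epsilon> s)"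
    by (simp add: yhat)
qed simp

lemma log_clus_seed_seq:
  assumes ev: "positive_hom A ev" and emb: "\<And>p. emb p \<in> A"
    and A: "\<And>j. j < n \<Longrightarrow> clus S j \<in> A \<and> ln (ev (clus S j)) = 0"
    and k: "\<And>s. s < T \<Longrightarrow> k s < n"
    and z: "\<And>s i. s \<le> T \<Longrightarrow> i < n \<Longrightarrow> ln (ev (emb (coef (seed_seq n k S s) i))) = z s i"
    and m: "\<And>s. s < T \<Longrightarrow> ln (ev (emb (1 + coef (seed_seq n k S s) (k s)))) = m s"
    and s: "s \<le> T" and i: "i < n"
  shows "ln (ev (clus (seed_seq n k S s) i)) = log_clus_seq softplus n (exch S) k z m s i"
  using s i
proof (induction s arbitrary: i)
  case 0
  then show ?case using A by simp
next
  case (Suc s)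
  let ?S = "seed_seq n k S s"
  let ?b = "exch_seq (exch S) k s" and ?c = "log_clus_seq softplus n (exch S) k z m s"
  have s: "s \<le> T" "s < T" using Suc.prems by simp_all
  have A': "clus ?S j \<in> A" if "j < n" for j
    using clus_seed_seq_in[where k = k and T = T, OF ev emb _ k s(1) that] A by blast
  have IH: "ln (ev (clus ?S j)) = ?c j" if "j < n" for j
    using Suc.IH[OF s(1) that] .
  have "ln (ev (yhat n ?S (k s))) =
      hat_log n ?b (\<lambda>i. ln (ev (emb (coef ?S i)))) (\<lambda>j. ln (ev (clus ?S j))) (k s)"
    using log_yhat(2)[OF positive_hom_log_hom[OF ev] emb A'] by (simp add: exch_seed_seq)
  also have "\<dots> = hat_log n ?b (z s) ?c (k s)"
    using z[OF s(1) k[OF s(2)]] by (simp add: hat_log_def IH)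
  finally have yhat: "ln (ev (yhat n ?S (k s))) = hat_log n ?b (z s) ?c (k s)" .
  have "ln (ev (clus (mutate n (k s) ?S) i)) =
      clus_step n ?b (k s) (softplus (hat_log n ?b (z s) ?c (k s)) - m s) (\<lambda>j. ln (ev (clus ?S j))) i"
    using log_clus_mutate(2)[OF ev emb A' k[OF s(2)] Suc.prems(2)]
    by (simp only: yhat m[OF s(2)] exch_seed_seq)
  also have "\<dots> = clus_step n ?b (k s) (softplus (hat_log n ?b (z s) ?c (k s)) - m s) ?c i"
    using IH Suc.prems(2) k[OF s(2)] by (simp add: clus_step_def)
  finally show ?case by simp
qed

text \<open>
  On the ray through \<open>t\<close>, the sum vanishes at \<open>r = 0\<close> by the identity in the \<open>x\<close>-variables at
  \<open>x = 1\<close>, and its value at \<open>r = 1\<close> is the sum in question.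
\<close>

lemma y_identities_if_x_identities:
  assumes P: x_dilogarithm_identities
  shows y_dilogarithm_identities
  unfolding y_dilogarithm_identities_def
proof (intro allI impI)
  fix n B T k \<sigma> d ev
  assume data: "periodic_mutation_data n B T k \<sigma> d"
    and ev: "semifield_hom (qplus_vars n) {0::real<..} ev"
  have k: "\<And>s. s < T \<Longrightarrow> k s < n" and d: "skew_symmetrizer n d B" and \<sigma>: "\<sigma> permutes {..<n}"
    and per: "\<And>i. i < n \<Longrightarrow> clus (qseed n B k T) (inv \<sigma> i) = xvar i"
    using data
    by (auto simp: periodic_mutation_data_def sigma_periodic_def qseed_def initial_seed_def)
  let ?\<epsilon> = "tropical_sign_seq n B k"
  \<comment> \<open>The values \<open>1\<close> outside the rank extend the evaluation to all of \<open>qplus\<close>, the group of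
    coefficients of the ambient field.\<close>
  define t where "t i = (if i < n then ev (yvar i) else 1)" for i
  have t: "t i > 0" for i
    using ev yvar_in_qplus_vars by (auto simp: t_def semifield_hom_def)
  obtain \<theta> where \<theta>: "semifield_hom UNIV {0<..} \<theta>" "\<And>i. \<theta> (yvar i) = t i"
    using qplus_hom_exists[of t] t by blast
  have \<theta>p: "positive_hom UNIV \<theta>" by (rule positive_hom_qplus[OF \<theta>(1)])
  have \<theta>_pos: "\<theta> p > 0" for p using \<theta>(1) by (simp add: semifield_hom_def)
  define \<tau> where "\<tau> i = ln (t i)" for i
  let ?z = "log_coef_seq B k \<tau>"
  let ?S = "initial_seed B yvar :: qplus seed"
  have z: "ln (\<theta> (coef (seed_seq n k ?S s) i)) = ?z s i" if "s \<le> T" "i < n" for s i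
    using log_coef_seed_seq(2)[where S = ?S and \<tau> = \<tau> and k = k and T = T, OF \<theta>p k _ that]
    by (simp add: initial_seed_def \<tau>_def \<theta>(2))
  have periodic: "log_clus_seq softplus n B k (\<lambda>s i. r * ?z s i) (\<lambda>s. r * softplus (?z s (k s))) T i = 0"
    if i: "i < n" for r i
  proof -
    let ?A = "gen_semifield (range xvar \<union> range emb) :: qplus ambient set"
    have "\<theta> (p * q) powr r = \<theta> p powr r * \<theta> q powr r" for p q
      using \<theta>(1) \<theta>_pos[of p] \<theta>_pos[of q] by (simp add: semifield_hom_def powr_mult)
    moreover have "\<theta> p powr r > 0" for p
      using \<theta>_pos[of p] by simp
    ultimately obtain ev' where hom: "semifield_hom ?A {0<..} ev'"
      and ev'_xvar: "\<And>i. ev' (xvar i) = 1" and ev'_emb: "\<And>p. ev' (emb p) = \<theta> p powr r"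
      using ambient_hom_exists[of "\<lambda>p. \<theta> p powr r" "\<lambda>_. 1"] zero_less_one by blast
    have ev': "positive_hom ?A ev'" by (rule positive_hom_gen_semifield[OF hom]) simp
    have emb: "emb p \<in> ?A" for p by (rule gen_semifield.gen) simp
    have xvar: "xvar i \<in> ?A" for i by (rule gen_semifield.gen) simp
    have ln_emb: "ln (ev' (emb p)) = r * ln (\<theta> p)" for p
      using \<theta>_pos[of p] by (simp add: ev'_emb ln_powr)
    have clus: "ln (ev' (clus (seed_seq n k ?S T) j)) =
        log_clus_seq softplus n B k (\<lambda>s i. r * ?z s i) (\<lambda>s. r * softplus (?z s (k s))) T j"
      if "j < n" for j
    proof -
      have "ln (ev' (clus (seed_seq n k ?S T) j)) =
        log_clus_seq softplus n (exch ?S) k (\<lambda>s i. r * ?z s i) (\<lambda>s. r * softplus (?z s (k s))) T j"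
      proof (rule log_clus_seed_seq[OF ev' emb _ k])
        show "clus ?S j \<in> ?A \<and> ln (ev' (clus ?S j)) = 0" for j
          by (simp add: initial_seed_def xvar ev'_xvar)
        show "ln (ev' (emb (coef (seed_seq n k ?S s) i))) = r * ?z s i" if "s \<le> T" "i < n" for s i
          by (simp only: ln_emb z[OF that])
        show "ln (ev' (emb (1 + coef (seed_seq n k ?S s) (k s)))) = r * softplus (?z s (k s))"
          if "s < T" for s
          using that k[OF that]
          by (simp add: ln_emb positive_hom_one_plus(2)[OF \<theta>p] z)
      qed (use that in simp_all)
      then show ?thesis by (simp add: initial_seed_def)
    qed
    have si: "\<sigma> i < n" using permutes_in_image[OF \<sigma>, of i] i by simp
    have "clus (seed_seq n k ?S T) i = xvar (\<sigma> i)"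
      using per[OF si] permutes_inverses(2)[OF \<sigma>, of i] by (simp add: qseed_def)
    then show ?thesis using clus[OF i] by (simp add: ev'_xvar)
  qed
  let ?A = "gen_semifield (range xvar \<union> range emb) :: unit ambient set"
  have "\<exists>ev. semifield_hom ?A {0::real<..} ev \<and> (\<forall>i. ev (xvar i) = 1) \<and> (\<forall>p. ev (emb p) = 1)"
    by (rule ambient_hom_exists) simp_all
  then obtain ev1 where hom: "semifield_hom ?A {0::real<..} ev1"
    and ev1_xvar: "\<And>i. ev1 (xvar i) = 1" and ev1_emb: "\<And>p. ev1 (emb p) = 1" by blast
  have ev1: "positive_hom ?A ev1" by (rule positive_hom_gen_semifield[OF hom]) simp
  have emb: "emb p \<in> ?A" for p by (rule gen_semifield.gen) simp
  have xvar: "xvar i \<in> ?A" for i by (rule gen_semifield.gen) simp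
  have hom': "semifield_hom (gen_semifield (xvar ` {..<n})) {0<..} ev1"
    by (rule semifield_hom_mono[OF hom gen_semifield_mono]) auto
  let ?I = "initial_seed B (\<lambda>_. 1) :: unit seed"
  have "ln (ev1 (yhat n ?I i)) = 0" for i
  proof -
    have "ln (ev1 (yhat n ?I i)) = hat_log n (exch ?I)
        (\<lambda>i. ln (ev1 (emb (coef ?I i)))) (\<lambda>j. ln (ev1 (clus ?I j))) i"
      by (rule log_yhat(2)[OF positive_hom_log_hom[OF ev1] emb])
        (simp only: initial_seed_def seed.simps xvar)
    then show ?thesis by (simp add: initial_seed_def hat_log_def ev1_xvar ev1_emb)
  qed
  then have "dilog_sum T B k d ?\<epsilon> (\<lambda>_. 0) = 0"
    using P data hom' dilog_sum_yhat[where k = k and T = T and \<epsilon> = ?\<epsilon>, OF ev1 xvar k d]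
    unfolding x_dilogarithm_identities_def by fastforce
  then have "dilog_sum T B k d ?\<epsilon> \<tau> = 0"
    using dilog_sum_const_on_ray[where k = k and T = T and \<tau> = \<tau> and \<epsilon> = ?\<epsilon>, OF d k tropical_sign_seq_cases periodic]
    by simp
  then show "(\<Sum>s<T. real_of_int (?\<epsilon> s) / real_of_int (d (k s)) *
            rogers_L (ev (coef (qseed n B k s) (k s)) powi ?\<epsilon> s)) = 0"
    using dilog_sum_coef[where k = k and T = T and \<epsilon> = ?\<epsilon> and \<tau> = \<tau> and n = n, OF positive_hom_qplus_vars[OF ev] k]
    by (simp add: yvar_in_qplus_vars \<tau>_def t_def)
qed

text \<open>
  Evaluate the identity in the \<open>y\<close>-variables at the values of the initial hatted variables.
\<close>

lemma x_identities_if_y_identities: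
  assumes Q: y_dilogarithm_identities
  shows x_dilogarithm_identities
  unfolding x_dilogarithm_identities_def
proof (intro allI impI)
  fix n B T k \<sigma> d and ev :: "unit ambient \<Rightarrow> real"
  assume data: "periodic_mutation_data n B T k \<sigma> d"
    and ev: "semifield_hom (gen_semifield (xvar ` {..<n})) {0::real<..} ev"
  have k: "\<And>s. s < T \<Longrightarrow> k s < n" and d: "skew_symmetrizer n d B" and n: "n \<ge> 1"
    using data by (auto simp: periodic_mutation_data_def)
  let ?\<epsilon> = "tropical_sign_seq n B k"
  let ?G = "gen_semifield (xvar ` {..<n}) :: unit ambient set"
  have "0 \<in> {..<n}" using n by simp
  then have evp: "positive_hom ?G ev"
    by (intro positive_hom_gen_semifield ev) blast
  define \<tau> where "\<tau> i = ln (ev (yhat n (initial_seed B (\<lambda>_. 1)) i))" for i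
  obtain \<theta> where \<theta>: "semifield_hom UNIV {0<..} \<theta>" "\<And>i. \<theta> (yvar i) = exp (\<tau> i)"
    using qplus_hom_exists[of "\<lambda>i. exp (\<tau> i)"] by auto
  have "semifield_hom (qplus_vars n) {0<..} \<theta>"
    by (rule semifield_hom_mono[OF \<theta>(1)]) simp
  then have "(\<Sum>s<T. real_of_int (?\<epsilon> s) / real_of_int (d (k s)) *
      rogers_L (\<theta> (coef (qseed n B k s) (k s)) powi ?\<epsilon> s)) = 0"
    using Q data unfolding y_dilogarithm_identities_def by blast
  then have "dilog_sum T B k d ?\<epsilon> \<tau> = 0"
    using dilog_sum_coef[where k = k and T = T and \<epsilon> = ?\<epsilon> and \<tau> = \<tau> and n = n and B = B and d = d,
        OF positive_hom_qplus[OF \<theta>(1)] k] \<theta>(2) by simp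
  then show "(\<Sum>s<T. real_of_int (?\<epsilon> s) / real_of_int (d (k s)) *
      rogers_L (ev (\<Prod>j<n. clus (tseed n B k s) j powi exch (tseed n B k s) j (k s)) powi ?\<epsilon> s)) = 0"
    using dilog_sum_yhat[where k = k and T = T and \<epsilon> = ?\<epsilon>, OF evp gen_semifield.gen k d]
    unfolding \<tau>_def by simp
qed

theorem theorem6p9:
  shows "(x_dilogarithm_identities \<longrightarrow> y_dilogarithm_identities) \<and>
         (x_dilogarithm_identities \<longleftrightarrow> y_dilogarithm_identities)"
  using y_identities_if_x_identities x_identities_if_y_identities by blast

end
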